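(* There exist a metric space $(X,D)$, a map $F:X\to X$ and a subset $W\subset X$ with $F(W)\subseteq W$ such that: (i) $X$ and $W$ are compact with respect to $D$, and $F:X\to X$ as well as $F\restriction W:W\to W$ are homeomorphisms. (ii) For some $\varepsilon>0$ we have $$\liminf_{T\to\infty}\frac{\ln \mathrm{sep}(X,\varepsilon,D_T)}{T}<\limsup_{T\to\infty}\frac{\ln \mathrm{sep}(X,\varepsilon,D_T)}{T},$$ $$\liminf_{T\to\infty}\frac{\ln \mathrm{sep}(W,\varepsilon,D_T)}{T}<\limsup_{T\to\infty}\frac{\ln \mathrm{sep}(W,\varepsilon,D_T)}{T}.$$ (iii) For all $\delta>0$, $$\liminf_{T\to\infty}\frac{\ln \mathrm{span}(W,\delta,D_T)}{T}=\limsup_{T\to\infty}\frac{\ln \mathrm{span}(W,\delta,D_T)}{T}.$$ Specifically, for some $\delta^*$ with $0<\delta^*<\varepsilon$ (where $\varepsilon$ is as in (ii)): (iiia) if $\delta>\delta^*$, then $\lim_{T\to\infty}\frac{\ln \mathrm{span}(X,\delta,D_T)}{T}=\lim_{T\to\infty}\frac{\ln \mathrm{span}(W,\delta,D_T)}{T}=0$; (iiib) if $0<\delta\le\delta^*$, then $\lim_{T\to\infty}\frac{\ln \mathrm{span}(W,\delta,D_T)}{T}=\ln 2$. (iv) $h(X,F)=\infty$ while $h(W,F\restriction W)=\ln 2$. (v) The system $(X,F)$ is not topologically transitive, while the system $(W,F\restriction W)$ is topologically transitive.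
   Context: For a metric space $(X,D)$, a continuous map $F:X\to X$ and an integer $T\ge 1$, $D_T(x,y)=\max\{D(F^t(x),F^t(y)):0\le t\le T-1\}$. Limits as $T\to\infty$ are over positive integers. For a metric $\mu$ and $\varepsilon>0$: a set of points is $\varepsilon$-separated if any two distinct points in it have $\mu$-distance $\ge\varepsilon$, and $\mathrm{sep}(Y,\varepsilon,\mu)$ is the maximum size of an $\varepsilon$-separated subset of $Y$; a set $S\subset Y$ is $\varepsilon$-spanning in $Y$ if for all $y\in Y$ there is $s\in S$ with $\mu(s,y)<\varepsilon$, and $\mathrm{span}(Y,\varepsilon,\mu)$ is the minimum size of an $\varepsilon$-spanning subset $S\subset Y$. The topological entropy is $h(X,F)=\lim_{\varepsilon\to0^+}\limsup_{T\to\infty}\frac{\ln \mathrm{span}(X,\varepsilon,D_T)}{T}\in[0,\infty]$. A system is topologically transitive if there exists at least one point with a dense forward orbit. *)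

theory Defs
  imports "HOL-Analysis.Analysis"
begin

text \<open>
  A dynamical system is given by a carrier \<open>Y\<close>, a metric \<open>D\<close> and a map \<open>F\<close> with \<open>F ` Y \<subseteq> Y\<close>.
  Only the values of \<open>F\<close> on \<open>Y\<close> matter below, so the restriction of \<open>F\<close> to an invariant
  subset \<open>W\<close> is the system \<open>W\<close>, \<open>D\<close>, \<open>F\<close>.
\<close>

definition bowen_metric :: "('a \<Rightarrow> 'a \<Rightarrow> real) \<Rightarrow> ('a \<Rightarrow> 'a) \<Rightarrow> nat \<Rightarrow> 'a \<Rightarrow> 'a \<Rightarrow> real" where
  "bowen_metric D F T x y = Max ((\<lambda>t. D ((F ^^ t) x) ((F ^^ t) y)) ` {..<T})"

definition eps_separated :: "('a \<Rightarrow> 'a \<Rightarrow> real) \<Rightarrow> real \<Rightarrow> 'a set \<Rightarrow> bool" where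
  "eps_separated \<mu> \<epsilon> S \<longleftrightarrow> (\<forall>x\<in>S. \<forall>y\<in>S. x \<noteq> y \<longrightarrow> \<mu> x y \<ge> \<epsilon>)"

definition eps_spanning :: "('a \<Rightarrow> 'a \<Rightarrow> real) \<Rightarrow> real \<Rightarrow> 'a set \<Rightarrow> 'a set \<Rightarrow> bool" where
  "eps_spanning \<mu> \<epsilon> Y S \<longleftrightarrow> S \<subseteq> Y \<and> (\<forall>y\<in>Y. \<exists>s\<in>S. \<mu> s y < \<epsilon>)"

text \<open>
  The next two numbers are meaningful when the sizes of separated sets are bounded and a finite
  spanning set exists, respectively; both hold for compact \<open>Y\<close> and continuous \<open>F\<close>.
\<close>

definition sep_number :: "'a set \<Rightarrow> real \<Rightarrow> ('a \<Rightarrow> 'a \<Rightarrow> real) \<Rightarrow> nat" where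
  "sep_number Y \<epsilon> \<mu> =
     (GREATEST n. \<exists>S. finite S \<and> S \<subseteq> Y \<and> eps_separated \<mu> \<epsilon> S \<and> card S = n)"

definition span_number :: "'a set \<Rightarrow> real \<Rightarrow> ('a \<Rightarrow> 'a \<Rightarrow> real) \<Rightarrow> nat" where
  "span_number Y \<epsilon> \<mu> = (LEAST n. \<exists>S. finite S \<and> eps_spanning \<mu> \<epsilon> Y S \<and> card S = n)"

text \<open>The values of the following rates at \<open>T = 0\<close> are irrelevant: only limits in \<open>T\<close> are taken.\<close>

definition sep_rate :: "'a set \<Rightarrow> ('a \<Rightarrow> 'a \<Rightarrow> real) \<Rightarrow> ('a \<Rightarrow> 'a) \<Rightarrow> real \<Rightarrow> nat \<Rightarrow> real" where
  "sep_rate Y D F \<epsilon> T = ln (real (sep_number Y \<epsilon> (bowen_metric D F T))) / real T"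

definition span_rate :: "'a set \<Rightarrow> ('a \<Rightarrow> 'a \<Rightarrow> real) \<Rightarrow> ('a \<Rightarrow> 'a) \<Rightarrow> real \<Rightarrow> nat \<Rightarrow> real" where
  "span_rate Y D F \<epsilon> T = ln (real (span_number Y \<epsilon> (bowen_metric D F T))) / real T"

definition top_entropy :: "'a set \<Rightarrow> ('a \<Rightarrow> 'a \<Rightarrow> real) \<Rightarrow> ('a \<Rightarrow> 'a) \<Rightarrow> ereal" where
  "top_entropy Y D F = Lim (at_right (0::real)) (\<lambda>\<epsilon>. limsup (\<lambda>T. ereal (span_rate Y D F \<epsilon> T)))"

definition top_transitive :: "'a set \<Rightarrow> ('a \<Rightarrow> 'a \<Rightarrow> real) \<Rightarrow> ('a \<Rightarrow> 'a) \<Rightarrow> bool" where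
  "top_transitive Y D F \<longleftrightarrow>
     (\<exists>x\<in>Y. Metric_space.mtopology Y D closure_of (range (\<lambda>t. (F ^^ t) x)) = Y)"

end

theory Submission
  imports Defs "HOL-Real_Asymp.Real_Asymp"
begin

text \<open>
  Let \<open>F\<close> be the shift. The subsystem \<open>W\<close> is the full shift on binary sequences (\<open>Bin\<close>), and \<open>X\<close>
  adds to it the shift on sequences in the interval from 2 to 3 (\<open>Thick\<close>), an invariant set of
  infinite entropy at distance 1 from \<open>W\<close>. The metric \<open>met\<close> is an ordinary metric \<open>rho \<le> 1\<close> of
  product type plus a bump with values between 0 and 1. The bump vanishes where \<open>rho < 1\<close>, so it
  changes neither the topology nor what happens at scales at most 1: spanning sets of \<open>W\<close> count
  binary words, and their rate is \<open>ln 2\<close>. It also vanishes unless both points show a codeword at the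
  origin, so the zero sequence is within distance 1 of all points, and spanning numbers above the
  scale 1 are equal to 1. The one thing that depends on the shape of the bump is separation at scale 2,
  that is, the set of pairs where the bump is 1. It is the closure of a relation \<open>far\<close>.

  The relation is built from the two-colouring of the complete graph on the integers mod 5 into two
  pentagons, exchanged by doubling, neither of which contains a triangle. For each length \<open>l = 36^n\<close>
  and each message \<open>w\<close> of \<open>l\<close> letters mod 5 there is a binary signal: the message, written with
  codewords of 9 bits, a pause of \<open>l\<close> bits, and the doubled message. Consider the first letter at which
  two messages differ. If the letters there are adjacent in the first pentagon, then the signals are
  moved to distance 2 at the time when this letter of the first copy passes the origin; otherwise the
  doubled letters are adjacent, and it happens when that letter of the second copy passes.

  Over the time \<open>19 * l\<close> of the whole signal, all \<open>5 ^ l\<close> signals become separated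
  (\<open>signals_far\<close>), which gives the rate \<open>ln 5 / 19\<close>. A window not longer than the pause, however,
  sees only one copy. The separated points then form a tree, branching where two of them
  first differ, and since the pentagon has no triangle, each node has at most two children
  (\<open>event_within_card\<close>). So a window of length \<open>T\<close> has about \<open>2 ^ (T/9)\<close> separated points. At \<open>T = 36 * l\<close>, with
  \<open>l = 36^n\<close>, this applies to the signals of all later levels, while those of the levels up to \<open>n\<close>
  contribute at most \<open>5 ^ l\<close> points times a polynomial in \<open>l\<close>, which is negligible against
  \<open>2 ^ (4 * l)\<close>. Hence the lower rate is at most \<open>ln 2 / 9\<close>, and this is less than \<open>ln 5 / 19\<close> because \<open>2 ^ 19 < 5 ^ 9\<close>.

  It is essential that only the first difference counts. If any position with adjacent letters
  could separate two points, then the words \<open>(a, 2 * a)\<close> would yield five points from two letters,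
  and concatenating such words a short window would reach the growth rate of whole signals.
\<close>

section \<open>The shift and the base metric\<close>

definition shift :: "(int \<Rightarrow> real) \<Rightarrow> int \<Rightarrow> real" where
  "shift x = (\<lambda>i. x (i + 1))"

lemma shift_funpow: "(shift ^^ t) x = (\<lambda>i. x (i + int t))"
  by (induction t) (auto simp: shift_def fun_eq_iff algebra_simps)

text \<open>
  Codewords have 9 bits. The weight is constant on all positions that a codeword at the origin
  occupies, so that two binary sequences with different codewords there have the maximal distance 1.
\<close>
definition weight :: "int \<Rightarrow> real" where
  "weight i = (1/2) ^ (nat \<bar>i\<bar> - 9)"

text \<open>
  The truncation at 1 makes every term bounded, so this is a metric on all sequences, and binary and
  thick sequences are at distance exactly 1.
\<close>
definition rho :: "(int \<Rightarrow> real) \<Rightarrow> (int \<Rightarrow> real) \<Rightarrow> real" where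
  "rho x y = (SUP i. weight i * min 1 \<bar>x i - y i\<bar>)"

lemma weight_pos [simp]: "0 < weight i"
  by (simp add: weight_def)

lemma weight_le_1: "weight i \<le> 1"
  by (simp add: weight_def power_le_one)

lemma weight_core: "\<bar>i\<bar> \<le> 9 \<Longrightarrow> weight i = 1"
  by (simp add: weight_def)

lemma weight_tail: "int (9 + m) < \<bar>i\<bar> \<Longrightarrow> weight i \<le> (1/2) ^ m"
  unfolding weight_def by (rule power_decreasing) auto

lemma weight_shift_le: "weight i \<le> 2 * weight (i + 1)" "weight (i + 1) \<le> 2 * weight i"
proof -
  have *: "weight i \<le> 2 * weight j" if "nat \<bar>j\<bar> - 9 \<le> Suc (nat \<bar>i\<bar> - 9)" for i j
  proof -
    have "(1/2::real) ^ Suc (nat \<bar>i\<bar> - 9) \<le> (1/2) ^ (nat \<bar>j\<bar> - 9)"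
      by (rule power_decreasing) (use that in auto)
    then show ?thesis by (simp add: weight_def)
  qed
  show "weight i \<le> 2 * weight (i + 1)" "weight (i + 1) \<le> 2 * weight i"
    by (rule *; linarith)+
qed

lemma rho_term_le_1: "weight i * min 1 \<bar>x i - y i\<bar> \<le> 1"
  by (rule mult_le_one) (auto simp: weight_le_1)

lemma rho_term_le: "weight i * min 1 \<bar>x i - y i\<bar> \<le> rho x y"
  unfolding rho_def by (rule cSUP_upper) (auto intro!: bdd_aboveI2 rho_term_le_1)

lemma rho_leI: "(\<And>i. weight i * min 1 \<bar>x i - y i\<bar> \<le> c) \<Longrightarrow> rho x y \<le> c"
  unfolding rho_def by (rule cSUP_least) auto

lemma rho_le_1: "rho x y \<le> 1"
  by (rule rho_leI) (rule rho_term_le_1)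

lemma rho_nonneg: "0 \<le> rho x y"
  by (rule order_trans[OF _ rho_term_le[of 0]]) (simp add: less_imp_le)

lemma rho_commute: "rho x y = rho y x"
  by (simp add: rho_def abs_minus_commute)

lemma rho_refl [simp]: "rho x x = 0"
  by (rule antisym) (auto intro: rho_leI rho_nonneg)

lemma rho_eq_0: "rho x y = 0 \<Longrightarrow> x = y"
proof
  fix i assume "rho x y = 0"
  with rho_term_le[of i x y] have "weight i * min 1 \<bar>x i - y i\<bar> \<le> 0" by simp
  then have "min 1 \<bar>x i - y i\<bar> \<le> 0" by (metis mult_le_cancel_left_pos mult_zero_right weight_pos)
  then show "x i = y i" by simp
qed

lemma rho_triangle: "rho x z \<le> rho x y + rho y z"
proof (rule rho_leI)
  fix i
  have "min 1 \<bar>x i - z i\<bar> \<le> min 1 \<bar>x i - y i\<bar> + min 1 \<bar>y i - z i\<bar>" by linarith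
  then have "weight i * min 1 \<bar>x i - z i\<bar>
      \<le> weight i * min 1 \<bar>x i - y i\<bar> + weight i * min 1 \<bar>y i - z i\<bar>"
    by (metis distrib_left less_imp_le mult_left_mono weight_pos)
  also have "\<dots> \<le> rho x y + rho y z" by (intro add_mono rho_term_le)
  finally show "weight i * min 1 \<bar>x i - z i\<bar> \<le> rho x y + rho y z" .
qed

lemma rho_core: "\<bar>i\<bar> \<le> 9 \<Longrightarrow> \<bar>x i - y i\<bar> \<ge> 1 \<Longrightarrow> rho x y = 1"
  using rho_term_le[of i x y] rho_le_1[of x y] by (simp add: weight_core)

lemma rho_le_window:
  assumes "\<And>i. \<bar>i\<bar> \<le> int (9 + m) \<Longrightarrow> \<bar>x i - y i\<bar> \<le> c" "(1/2) ^ m \<le> c"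
  shows "rho x y \<le> c"
proof (rule rho_leI)
  fix i
  show "weight i * min 1 \<bar>x i - y i\<bar> \<le> c"
  proof (cases "\<bar>i\<bar> \<le> int (9 + m)")
    case True
    have "weight i * min 1 \<bar>x i - y i\<bar> \<le> 1 * \<bar>x i - y i\<bar>"
      by (intro mult_mono) (auto simp: weight_le_1)
    with assms(1)[OF True] show ?thesis by simp
  next
    case False
    have "weight i * min 1 \<bar>x i - y i\<bar> \<le> (1/2) ^ m * 1"
      using False by (intro mult_mono weight_tail) auto
    with assms(2) show ?thesis by simp
  qed
qed

lemma rho_shift: "rho (shift x) (shift y) \<le> 2 * rho x y"
proof (rule rho_leI)
  fix i
  have "weight i * min 1 \<bar>shift x i - shift y i\<bar>
      \<le> (2 * weight (i + 1)) * min 1 \<bar>x (i + 1) - y (i + 1)\<bar>"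
    unfolding shift_def by (intro mult_right_mono weight_shift_le) auto
  also have "\<dots> \<le> 2 * rho x y" using rho_term_le[of "i + 1" x y] by simp
  finally show "weight i * min 1 \<bar>shift x i - shift y i\<bar> \<le> 2 * rho x y" .
qed

lemma rho_unshift: "rho (\<lambda>i. x (i - 1)) (\<lambda>i. y (i - 1)) \<le> 2 * rho x y"
proof (rule rho_leI)
  fix i
  have "weight i * min 1 \<bar>x (i - 1) - y (i - 1)\<bar>
      \<le> (2 * weight (i - 1)) * min 1 \<bar>x (i - 1) - y (i - 1)\<bar>"
    using weight_shift_le(2)[of "i - 1"] by (intro mult_right_mono) auto
  also have "\<dots> \<le> 2 * rho x y" using rho_term_le[of "i - 1" x y] by simp
  finally show "weight i * min 1 \<bar>x (i - 1) - y (i - 1)\<bar> \<le> 2 * rho x y" .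
qed

lemma rho_shift_funpow: "rho ((shift ^^ t) x) ((shift ^^ t) y) \<le> 2 ^ t * rho x y"
proof (induction t)
  case (Suc t)
  show ?case using rho_shift[of "(shift ^^ t) x" "(shift ^^ t) y"] Suc by simp
qed simp

section \<open>Binary and thick sequences\<close>

definition Bin :: "(int \<Rightarrow> real) set" where
  "Bin = {x. \<forall>i. x i \<in> {0, 1}}"

definition Thick :: "(int \<Rightarrow> real) set" where
  "Thick = {x. \<forall>i. x i \<in> {2..3}}"

abbreviation "Full \<equiv> Bin \<union> Thick"

lemma Bin_dist: "x \<in> Bin \<Longrightarrow> y \<in> Bin \<Longrightarrow> x i \<noteq> y i \<Longrightarrow> \<bar>x i - y i\<bar> = 1"
proof -
  assume "x \<in> Bin" "y \<in> Bin" "x i \<noteq> y i"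
  then have "x i = 0 \<or> x i = 1" "y i = 0 \<or> y i = 1" by (auto simp: Bin_def)
  with \<open>x i \<noteq> y i\<close> show ?thesis by auto
qed

lemma rho_Bin_less:
  assumes "x \<in> Bin" "y \<in> Bin" "rho x y < (1/2) ^ m" "\<bar>i\<bar> \<le> int (9 + m)"
  shows "x i = y i"
proof (rule ccontr)
  assume "x i \<noteq> y i"
  then have "weight i \<le> rho x y"
    using rho_term_le[of i x y] Bin_dist[OF assms(1,2)] by simp
  moreover have "(1/2) ^ m \<le> weight i"
    unfolding weight_def by (rule power_decreasing) (use assms(4) in auto)
  ultimately show False using assms(3) by simp
qed

lemma rho_Bin_Thick: "x \<in> Bin \<Longrightarrow> y \<in> Thick \<Longrightarrow> rho x y = 1"
  by (rule rho_core[of 0]) (auto simp: Bin_def Thick_def dest!: spec[of _ "0::int"])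

lemma rho_less_1_Bin:
  assumes "x \<in> Full" "u \<in> Bin" "rho x u < 1"
  shows "x \<in> Bin" "\<bar>i\<bar> \<le> 9 \<Longrightarrow> x i = u i"
proof -
  show "x \<in> Bin" using assms rho_Bin_Thick[of u x] by (auto simp: rho_commute)
  then show "\<bar>i\<bar> \<le> 9 \<Longrightarrow> x i = u i" using rho_Bin_less[of x u 0 i] assms by simp
qed

lemma shift_Bin: "shift x \<in> Bin \<longleftrightarrow> x \<in> Bin"
  and shift_Thick: "shift x \<in> Thick \<longleftrightarrow> x \<in> Thick"
proof -
  have "(\<forall>i. P (x (i + 1))) \<longleftrightarrow> (\<forall>i. P (x i))" for P
    by (metis diff_add_cancel)
  then show "shift x \<in> Bin \<longleftrightarrow> x \<in> Bin" "shift x \<in> Thick \<longleftrightarrow> x \<in> Thick"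
    unfolding shift_def Bin_def Thick_def by simp_all
qed

lemma shift_funpow_Bin: "(shift ^^ t) x \<in> Bin \<longleftrightarrow> x \<in> Bin"
  and shift_funpow_Thick: "(shift ^^ t) x \<in> Thick \<longleftrightarrow> x \<in> Thick"
  by (induction t) (simp_all add: shift_Bin shift_Thick)

section \<open>Codewords and events\<close>

text \<open>
  The prefix 11 occurs nowhere else in a codeword or across its end, which makes codewords
  recognisable without any marker for the positions where they start; the third 1 encodes the letter.
\<close>
definition code :: "int \<Rightarrow> int \<Rightarrow> real" where
  "code a q = of_bool (q = 0 \<or> q = 1 \<or> q = a + 3)"

definition reads :: "(int \<Rightarrow> real) \<Rightarrow> int \<Rightarrow> int \<Rightarrow> bool" where
  "reads x t a \<longleftrightarrow> 0 \<le> a \<and> a < 5 \<and> (\<forall>q. 0 \<le> q \<and> q < 9 \<longrightarrow> x (t + q) = code a q)"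

text \<open>
  The edges of a pentagon on the letters mod 5.
\<close>
definition adj :: "int \<Rightarrow> int \<Rightarrow> bool" where
  "adj a b \<longleftrightarrow> (a - b) mod 5 = 1 \<or> (a - b) mod 5 = 4"

text \<open>
  Adjacent letters are distinct, so an event keeps the two points apart near \<open>t\<close>.
\<close>
definition event :: "(int \<Rightarrow> real) \<Rightarrow> (int \<Rightarrow> real) \<Rightarrow> int \<Rightarrow> bool" where
  "event x y t \<longleftrightarrow> (\<exists>a b. reads x t a \<and> reads y t b \<and> adj a b)"

lemma adj_sym: "adj a b \<Longrightarrow> adj b a"
  unfolding adj_def by presburger

lemma adj_irrefl: "\<not> adj a a"
  by (simp add: adj_def)

text \<open>
  The sum of two elements of \<open>{1, 4}\<close> mod 5 is 0, 2 or 3.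
\<close>
lemma adj_triangle_free: "adj a b \<Longrightarrow> adj b c \<Longrightarrow> \<not> adj a c"
proof -
  assume "adj a b" "adj b c"
  moreover have "(a - c) mod 5 = ((a - b) mod 5 + (b - c) mod 5) mod 5" by (simp add: mod_add_eq)
  ultimately show ?thesis by (auto simp: adj_def)
qed

text \<open>
  Doubling maps the diagonals of the pentagon to its edges.
\<close>
lemma adj_or_adj_double:
  assumes "0 \<le> a" "a < 5" "0 \<le> b" "b < 5" "a \<noteq> b"
  shows "adj a b \<or> adj (2 * a mod 5) (2 * b mod 5)"
proof -
  have "a \<in> {0, 1, 2, 3, 4}" "b \<in> {0, 1, 2, 3, 4}" using assms by auto
  with assms(5) show ?thesis by (auto simp: adj_def)
qed

lemma event_sym: "event x y t \<Longrightarrow> event y x t"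
  unfolding event_def using adj_sym by blast

lemma reads_unique: "reads x t a \<Longrightarrow> reads x t b \<Longrightarrow> a = b"
proof -
  assume "reads x t a" "reads x t b"
  then have "code a (b + 3) = code b (b + 3)" "0 \<le> a" "0 \<le> b"
    by (auto simp: reads_def)
  then show "a = b" by (auto simp: code_def split: if_splits)
qed

lemma reads_cong: "reads x t a \<Longrightarrow> (\<And>q. 0 \<le> q \<Longrightarrow> q < 9 \<Longrightarrow> y (t + q) = x (t + q)) \<Longrightarrow> reads y t a"
  by (simp add: reads_def)

text \<open>
  Otherwise the prefix 11 of the later codeword would lie inside the earlier one or straddle its last bit, which is 0.
\<close>
lemma reads_no_overlap:
  assumes "reads x t a" "reads x s b" "t < s" shows "t + 9 \<le> s"
proof (rule ccontr)
  assume *: "\<not> t + 9 \<le> s"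
  define d where "d = s - t"
  have d: "0 < d" "d < 9" using * assms(3) by (auto simp: d_def)
  have a: "0 \<le> a" "a < 5" using assms by (auto simp: reads_def)
  have x: "x (t + q) = code a q" if "0 \<le> q" "q < 9" for q
    using assms that by (auto simp: reads_def)
  have y: "x (s + q) = code b q" if "0 \<le> q" "q < 9" for q
    using assms that by (auto simp: reads_def)
  have "code a d = 1" using x[of d] y[of 0] d by (simp add: d_def code_def)
  moreover from this have "d \<noteq> 8" using a d by (auto simp: code_def)
  then have "code a (d + 1) = 1" using x[of "d + 1"] y[of 1] d by (simp add: d_def code_def add_ac)
  ultimately show False using a d by (auto simp: code_def split: if_splits)
qed

lemma event_differ:
  assumes "event x y t" obtains q where "0 \<le> q" "q < 9" "x (t + q) \<noteq> y (t + q)"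
proof -
  obtain a b where ab: "reads x t a" "reads y t b" "adj a b" using assms by (auto simp: event_def)
  have "\<exists>q. 0 \<le> q \<and> q < 9 \<and> x (t + q) \<noteq> y (t + q)"
  proof (rule ccontr)
    assume "\<not> ?thesis"
    then have "reads y t a" by (intro reads_cong[OF ab(1)]) auto
    with ab show False using reads_unique adj_irrefl by blast
  qed
  with that show ?thesis by blast
qed

section \<open>A clique in a short window is a binary tree\<close>

text \<open>
  Agreement before the event is demanded only inside the window. The pairs in \<open>far\<close> below agree on a
  limited past, which covers the window if the window is short enough.
\<close>
definition event_within :: "int \<Rightarrow> int \<Rightarrow> (int \<Rightarrow> real) \<Rightarrow> (int \<Rightarrow> real) \<Rightarrow> bool" where
  "event_within s e x y \<longleftrightarrow> (\<exists>t. s \<le> t \<and> t < e \<and> (\<forall>i. s \<le> i \<and> i < t \<longrightarrow> x i = y i) \<and> event x y t)"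

text \<open>
  All points of \<open>S\<close> agree up to the earliest event time, and since codewords do not overlap, each of
  them has a codeword there. Distinct letters at this place are pairwise adjacent, so at most two
  letters occur. Points with the same letter agree for 9 more positions, and induction applies to
  each of the two classes.
\<close>
lemma event_within_card:
  assumes "finite S"
    and "\<And>x y. x \<in> S \<Longrightarrow> y \<in> S \<Longrightarrow> x \<noteq> y \<Longrightarrow> event_within s (s + 9 * int k) x y"
  shows "card S \<le> 2 ^ k"
  using assms
proof (induction k arbitrary: s S)
  case 0
  then have "x = y" if "x \<in> S" "y \<in> S" for x y
    using that by (force simp: event_within_def)
  then have "card S \<le> 1" using card_le_Suc0_iff_eq[OF 0(1)] by simp
  then show ?case by simp
next
  case (Suc k)
  define e where "e = s + 9 * int (Suc k)"
  show ?case
  proof (cases "\<exists>x\<in>S. \<exists>y\<in>S. x \<noteq> y")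
    case False
    then have "card S \<le> 1" using card_le_Suc0_iff_eq[OF Suc.prems(1)] by auto
    also have "\<dots> \<le> 2 ^ Suc k" by (rule one_le_power) simp
    finally show ?thesis .
  next
    case True
    \<comment> \<open>Event times are counted from \<open>s\<close>, so that the earliest one is a least natural number.\<close>
    define Q where "Q n \<longleftrightarrow> (\<exists>x\<in>S. \<exists>y\<in>S. x \<noteq> y \<and> s + int n < e \<and>
        (\<forall>i. s \<le> i \<and> i < s + int n \<longrightarrow> x i = y i) \<and> event x y (s + int n))" for n
    have exQ: "\<exists>n. Q n \<and> n = nat (t - s)"
      if "x \<in> S" "y \<in> S" "x \<noteq> y" "s \<le> t" "t < e" "\<forall>i. s \<le> i \<and> i < t \<longrightarrow> x i = y i" "event x y t" for x y t
      unfolding Q_def using that by (intro exI[of _ "nat (t - s)"]) auto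
    from True obtain x y where "x \<in> S" "y \<in> S" "x \<noteq> y" by blast
    with Suc.prems(2)[of x y] exQ have "\<exists>n. Q n" unfolding event_within_def e_def by metis
    define n where "n = (LEAST n. Q n)"
    have Qn: "Q n" and least: "\<And>m. Q m \<Longrightarrow> n \<le> m"
      using \<open>\<exists>n. Q n\<close> unfolding n_def by (auto intro: LeastI Least_le)
    define t where "t = s + int n"
    obtain x0 y0 where x0: "x0 \<in> S" "y0 \<in> S" "x0 \<noteq> y0" and "event x0 y0 t"
      using Qn unfolding Q_def t_def by blast
    then obtain a0 where a0: "reads x0 t a0" unfolding event_def by blast
    have ev: "\<exists>t'\<ge>t. t' < e \<and> (\<forall>i. s \<le> i \<and> i < t' \<longrightarrow> x i = y i) \<and> event x y t'"
      if xy: "x \<in> S" "y \<in> S" "x \<noteq> y" for x y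
    proof -
      obtain t' where t': "s \<le> t'" "t' < e" "\<forall>i. s \<le> i \<and> i < t' \<longrightarrow> x i = y i" "event x y t'"
        using Suc.prems(2)[OF xy] unfolding event_within_def e_def by blast
      have "Q (nat (t' - s))" using exQ[OF xy t'] by blast
      from least[OF this] have "t \<le> t'" unfolding t_def using t'(1) by linarith
      with t' show ?thesis by blast
    qed
    have reads_t: "\<exists>a. reads z t a" if "z \<in> S" for z
    proof (cases "z = x0")
    case False
      then obtain t' where t': "t \<le> t'" "\<forall>i. s \<le> i \<and> i < t' \<longrightarrow> x0 i = z i" "event x0 z t'"
        using ev[OF x0(1) \<open>z \<in> S\<close>] by blast
      show ?thesis
      proof (cases "t' = t")
        case True then show ?thesis using t'(3) by (auto simp: event_def)
      next
        case False
        obtain b where "reads x0 t' b" using t'(3) by (auto simp: event_def)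
        then have "t + 9 \<le> t'" using reads_no_overlap[OF a0] False t'(1) by force
        then have "reads z t a0" using t'(2)
          by (intro reads_cong[OF a0]) (auto simp: t_def)
        then show ?thesis ..
      qed
    qed (use a0 in blast)
    define letter where "letter z = (THE a. reads z t a)" for z
    have letter: "reads z t (letter z)" if "z \<in> S" for z
      unfolding letter_def using reads_t[OF that] reads_unique by (metis theI)
    have letter_adj: "adj (letter x) (letter y)" if xy: "x \<in> S" "y \<in> S" "letter x \<noteq> letter y" for x y
    proof -
      obtain t' where t': "t \<le> t'" "\<forall>i. s \<le> i \<and> i < t' \<longrightarrow> x i = y i" "event x y t'"
        using ev[OF xy(1,2)] xy(3) by blast
      have "t' = t"
      proof (rule ccontr)
        assume "t' \<noteq> t"
        obtain b where "reads x t' b" using t'(3) by (auto simp: event_def)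
        then have "t + 9 \<le> t'" using reads_no_overlap[OF letter[OF xy(1)]] \<open>t' \<noteq> t\<close> t'(1) by force
        then have "reads y t (letter x)" using t'(2)
          by (intro reads_cong[OF letter[OF xy(1)]]) (auto simp: t_def)
        then show False using reads_unique letter[OF xy(2)] xy(3) by blast
      qed
      then show ?thesis using t'(3) letter[OF xy(1)] letter[OF xy(2)] reads_unique
        unfolding event_def by metis
    qed
    have class_card: "card {z \<in> S. letter z = a} \<le> 2 ^ k" for a
    proof (rule Suc.IH[where s = "s + 9"])
      show "finite {z \<in> S. letter z = a}" using Suc.prems(1) by simp
      fix x y assume "x \<in> {z \<in> S. letter z = a}" "y \<in> {z \<in> S. letter z = a}" "x \<noteq> y"
      then have xy: "x \<in> S" "y \<in> S" "x \<noteq> y" "letter x = letter y" by auto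
      obtain t' where t': "t \<le> t'" "t' < e" "\<forall>i. s \<le> i \<and> i < t' \<longrightarrow> x i = y i" "event x y t'"
        using ev[OF xy(1-3)] by blast
      have "t' \<noteq> t"
        using t'(4) letter[OF xy(1)] letter[OF xy(2)] xy(4) reads_unique adj_irrefl
        unfolding event_def by metis
      obtain b where "reads x t' b" using t'(4) by (auto simp: event_def)
      then have "t + 9 \<le> t'" using reads_no_overlap[OF letter[OF xy(1)]] \<open>t' \<noteq> t\<close> t'(1) by force
      then show "event_within (s + 9) (s + 9 + 9 * int k) x y"
        unfolding event_within_def using t' by (intro exI[of _ t']) (auto simp: t_def e_def)
    qed
    have "card (letter ` S) \<le> 2"
    proof (rule ccontr)
      assume "\<not> ?thesis"
      then have "3 \<le> card (letter ` S)" by simp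
      then obtain C where "C \<subseteq> letter ` S" "card C = 3"
        by (metis obtain_subset_with_card_n)
      then obtain a b c where C: "C = {a, b, c}" "a \<noteq> b" "b \<noteq> c" "a \<noteq> c"
        by (meson card_3_iff)
      have "a \<in> letter ` S" "b \<in> letter ` S" "c \<in> letter ` S"
        using \<open>C \<subseteq> letter ` S\<close> unfolding C(1) by simp_all
      then have "adj a b" "adj b c" "adj a c"
        using letter_adj C(2-4) by (metis imageE)+
      then show False using adj_triangle_free by blast
    qed
    have "card S = card (\<Union>a\<in>letter ` S. {z \<in> S. letter z = a})"
      by (rule arg_cong[of _ _ card]) auto
    also have "\<dots> \<le> (\<Sum>a\<in>letter ` S. card {z \<in> S. letter z = a})"
      using Suc.prems(1) by (intro card_UN_le) simp
    also have "\<dots> \<le> (\<Sum>a\<in>letter ` S. 2 ^ k)" by (intro sum_mono class_card)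
    also have "\<dots> \<le> 2 ^ Suc k" using \<open>card (letter ` S) \<le> 2\<close> by simp
    finally show ?thesis .
  qed
qed

section \<open>The relation of pairs at distance two\<close>

text \<open>
  The pause at level \<open>n + 1\<close> is as long as the window \<open>36 * len n\<close> that is used for the lower rate.
\<close>
definition len :: "nat \<Rightarrow> nat" where
  "len n = 36 ^ n"

definition messages :: "nat \<Rightarrow> (int \<Rightarrow> int) set" where
  "messages n = {0..<int (len n)} \<rightarrow>\<^sub>E {0..<5}"

text \<open>
  The pause of one bit per letter is a compromise: longer windows should fit into it, but it delays
  the separation of the signals and must keep \<open>ln 5 / 19\<close> above \<open>ln 2 / 9\<close>.
\<close>
definition signal :: "nat \<Rightarrow> (int \<Rightarrow> int) \<Rightarrow> int \<Rightarrow> real" where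
  "signal n w i =
     (let l = int (len n) in
      if 0 \<le> i \<and> i < 9 * l then code (w (i div 9)) (i mod 9)
      else if 10 * l \<le> i \<and> i < 19 * l
        then code (2 * w ((i - 10 * l) div 9) mod 5) ((i - 10 * l) mod 9)
      else 0)"

definition level :: "nat \<Rightarrow> (int \<Rightarrow> real) set" where
  "level n = (\<lambda>(t, w). (shift ^^ t) (signal n w)) ` ({..<19 * len n} \<times> messages n)"

text \<open>
  The agreement on the last \<open>len n\<close> positions holds for both kinds of events of a signal: before the
  first difference of the first copies there is no earlier difference at all, and before that of the
  second copies there is the pause. It is what survives in the limit \<open>n \<rightarrow> \<infinity>\<close>: limits of pairs of
  growing level agree on the whole past.
\<close>
definition far :: "((int \<Rightarrow> real) \<times> (int \<Rightarrow> real)) set" where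
  "far = {(x, y). \<exists>n. x \<in> level n \<and> y \<in> level n \<and> event x y 0 \<and>
                      (\<forall>i. - int (len n) \<le> i \<and> i < 0 \<longrightarrow> x i = y i)}"

lemma len_pos [simp]: "0 < len n"
  by (simp add: len_def)

lemma len_mono: "m \<le> n \<Longrightarrow> len m \<le> len n"
  by (simp add: len_def)

lemma finite_messages [simp]: "finite (messages n)"
  by (simp add: messages_def finite_PiE)

lemma card_messages: "card (messages n) = 5 ^ len n"
  by (simp add: messages_def card_PiE)

lemma messages_letter: "w \<in> messages n \<Longrightarrow> 0 \<le> p \<Longrightarrow> p < int (len n) \<Longrightarrow> 0 \<le> w p \<and> w p < 5"
  unfolding messages_def by (force simp: PiE_iff)

lemma finite_level: "finite (level n)"
  by (simp add: level_def)

lemma card_level: "card (level n) \<le> 19 * len n * 5 ^ len n"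
proof -
  have "card (level n) \<le> card ({..<19 * len n} \<times> messages n)"
    unfolding level_def by (rule card_image_le) simp
  then show ?thesis by (simp add: card_cartesian_product card_messages)
qed

lemma signal_Bin: "signal n w \<in> Bin"
proof -
  have "code a q \<in> {0, 1}" for a q by (simp add: code_def)
  then show ?thesis unfolding Bin_def signal_def Let_def by simp
qed

lemma level_Bin: "level n \<subseteq> Bin"
  by (auto simp: level_def shift_funpow_Bin signal_Bin)

lemma reads_signal:
  assumes w: "w \<in> messages n" and p: "0 \<le> p" "p < int (len n)"
  shows "reads (signal n w) (9 * p) (w p)"
    and "reads (signal n w) (10 * int (len n) + 9 * p) (2 * w p mod 5)"
proof -
  have div: "(9 * p + q) div 9 = p" "(9 * p + q) mod 9 = q" if "0 \<le> q" "q < 9" for q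
    using that by simp_all
  from div show "reads (signal n w) (9 * p) (w p)"
    using messages_letter[OF w p] p unfolding reads_def signal_def Let_def by auto
  from div show "reads (signal n w) (10 * int (len n) + 9 * p) (2 * w p mod 5)"
    using p unfolding reads_def signal_def Let_def by auto
qed

lemma inj_signal: "inj_on (signal n) (messages n)"
proof (rule inj_onI)
  fix v w assume *: "v \<in> messages n" "w \<in> messages n" "signal n v = signal n w"
  show "v = w"
  proof (rule PiE_ext)
    show "v \<in> {0..<int (len n)} \<rightarrow>\<^sub>E {0..<5}" "w \<in> {0..<int (len n)} \<rightarrow>\<^sub>E {0..<5}"
      using * by (auto simp: messages_def)
    fix p assume "p \<in> {0..<int (len n)}"
    then show "v p = w p"
      using reads_signal(1)[OF *(1), of p] reads_signal(1)[OF *(2), of p]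
      by (simp add: *(3)) (rule reads_unique)
  qed
qed

lemma signal_prefix:
  assumes "\<And>q. 0 \<le> q \<Longrightarrow> q < p \<Longrightarrow> v q = w q" "p < int (len n)"
  shows "i < 9 * p \<Longrightarrow> signal n v i = signal n w i"
    and "9 * int (len n) \<le> i \<Longrightarrow> i < 10 * int (len n) + 9 * p \<Longrightarrow> signal n v i = signal n w i"
proof -
  show "signal n v i = signal n w i" if "i < 9 * p"
  proof (cases "0 \<le> i")
    case True
    then have "v (i div 9) = w (i div 9)" using that by (intro assms(1)) auto
    then show ?thesis using that assms(2) by (simp add: signal_def Let_def)
  qed (use that assms(2) in \<open>auto simp: signal_def Let_def\<close>)
  show "signal n v i = signal n w i" if "9 * int (len n) \<le> i" "i < 10 * int (len n) + 9 * p"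
  proof (cases "10 * int (len n) \<le> i")
    case True
    define j where "j = i - 10 * int (len n)"
    have "v (j div 9) = w (j div 9)" using that True by (intro assms(1)) (auto simp: j_def)
    then show ?thesis using that True assms(2) by (simp add: signal_def Let_def j_def)
  qed (use that in \<open>auto simp: signal_def Let_def\<close>)
qed

text \<open>
  Look at the first letter in which the messages differ. One of the two pentagons has these letters as
  an edge, and this decides which of the two copies separates the signals.
\<close>
lemma signals_far:
  assumes v: "v \<in> messages n" and w: "w \<in> messages n" and "v \<noteq> w"
  shows "\<exists>t<19 * len n. ((shift ^^ t) (signal n v), (shift ^^ t) (signal n w)) \<in> far"
proof -
  define l where "l = int (len n)"
  have "\<exists>p. 0 \<le> p \<and> p < l \<and> v p \<noteq> w p"
  proof (rule ccontr)
    assume "\<not> ?thesis"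
    then have "v = w" using v w unfolding messages_def l_def by (intro PiE_ext) auto
    with \<open>v \<noteq> w\<close> show False ..
  qed
  then have exm: "\<exists>m. int m < l \<and> v (int m) \<noteq> w (int m)" by (metis zero_le_imp_eq_int)
  define m where "m = (LEAST m. int m < l \<and> v (int m) \<noteq> w (int m))"
  have m: "int m < l" "v (int m) \<noteq> w (int m)"
    using LeastI_ex[OF exm] unfolding m_def by auto
  have before: "v q = w q" if "0 \<le> q" "q < int m" for q
  proof (rule ccontr)
    assume "v q \<noteq> w q"
    then have "m \<le> nat q" unfolding m_def using that m(1) by (intro Least_le) auto
    with that show False by simp
  qed
  have far: "((shift ^^ t) (signal n v), (shift ^^ t) (signal n w)) \<in> far"
    if t: "t < 19 * len n" and ev: "event (signal n v) (signal n w) (int t)"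
      and agree: "\<And>i. int t - l \<le> i \<Longrightarrow> i < int t \<Longrightarrow> signal n v i = signal n w i" for t
  proof -
    have "(shift ^^ t) (signal n v) \<in> level n" "(shift ^^ t) (signal n w) \<in> level n"
      using t v w unfolding level_def by auto
    moreover have "event ((shift ^^ t) (signal n v)) ((shift ^^ t) (signal n w)) 0"
      using ev by (simp add: event_def reads_def shift_funpow add.commute)
    moreover have "\<forall>i. - int (len n) \<le> i \<and> i < 0 \<longrightarrow> (shift ^^ t) (signal n v) i = (shift ^^ t) (signal n w) i"
      using agree by (auto simp: shift_funpow l_def)
    ultimately show ?thesis unfolding far_def by blast
  qed
  have p: "0 \<le> int m" "int m < int (len n)" using m by (auto simp: l_def)
  have letters: "0 \<le> v (int m)" "v (int m) < 5" "0 \<le> w (int m)" "w (int m) < 5"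
    using messages_letter[OF v p] messages_letter[OF w p] by auto
  from adj_or_adj_double[OF letters m(2)] show ?thesis
  proof
    assume "adj (v (int m)) (w (int m))"
    then have "event (signal n v) (signal n w) (int (9 * m))"
      using reads_signal(1)[OF v p] reads_signal(1)[OF w p] unfolding event_def by auto
    then have "((shift ^^ (9 * m)) (signal n v), (shift ^^ (9 * m)) (signal n w)) \<in> far"
      using p signal_prefix(1)[OF before p(2)] by (intro far) auto
    then show ?thesis using p by (intro exI[of _ "9 * m"]) auto
  next
    assume "adj (2 * v (int m) mod 5) (2 * w (int m) mod 5)"
    then have "event (signal n v) (signal n w) (int (10 * len n + 9 * m))"
      using reads_signal(2)[OF v p] reads_signal(2)[OF w p] unfolding event_def by auto
    then have "((shift ^^ (10 * len n + 9 * m)) (signal n v),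
                (shift ^^ (10 * len n + 9 * m)) (signal n w)) \<in> far"
      using p signal_prefix(2)[OF before p(2)] by (intro far) (auto simp: l_def)
    then show ?thesis using p by (intro exI[of _ "10 * len n + 9 * m"]) auto
  qed
qed

section \<open>The metric\<close>

text \<open>
  The distance of the pair \<open>(x, y)\<close> to \<open>far\<close> in the maximum metric, truncated at 1 by the inserted element.
\<close>
definition dist_far :: "(int \<Rightarrow> real) \<Rightarrow> (int \<Rightarrow> real) \<Rightarrow> real" where
  "dist_far x y = Inf (insert 1 ((\<lambda>(u, v). max (rho x u) (rho y v)) ` far))"

definition met :: "(int \<Rightarrow> real) \<Rightarrow> (int \<Rightarrow> real) \<Rightarrow> real" where
  "met x y = rho x y + (1 - dist_far x y)"

lemma far_bdd: "bdd_below (insert 1 ((\<lambda>(u, v). max (rho x u) (rho y v)) ` far))"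
  by (rule bdd_belowI[where m = 0]) (auto simp: rho_nonneg le_max_iff_disj)

lemma dist_far_le_1: "dist_far x y \<le> 1"
  unfolding dist_far_def by (rule cInf_lower[OF _ far_bdd]) simp

lemma dist_far_nonneg: "0 \<le> dist_far x y"
  unfolding dist_far_def by (rule cInf_greatest) (auto simp: rho_nonneg le_max_iff_disj)

lemma dist_far_le: "(u, v) \<in> far \<Longrightarrow> dist_far x y \<le> max (rho x u) (rho y v)"
  unfolding dist_far_def by (rule cInf_lower[OF _ far_bdd]) force

lemma dist_far_less:
  assumes "dist_far x y < c" "c \<le> 1"
  obtains u v where "(u, v) \<in> far" "rho x u < c" "rho y v < c"
proof -
  obtain z where "z \<in> insert 1 ((\<lambda>(u, v). max (rho x u) (rho y v)) ` far)" "z < c"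
    using cInf_lessD[OF _ assms(1)[unfolded dist_far_def]] by blast
  with assms(2) that show ?thesis by auto
qed

lemma far_sym: "(u, v) \<in> far \<Longrightarrow> (v, u) \<in> far"
  unfolding far_def using event_sym by fastforce

lemma far_Bin: "(u, v) \<in> far \<Longrightarrow> u \<in> Bin \<and> v \<in> Bin"
  unfolding far_def using level_Bin by blast

lemma dist_far_commute: "dist_far x y = dist_far y x"
proof -
  have "(\<lambda>(u, v). max (rho x u) (rho y v)) ` far \<subseteq> (\<lambda>(u, v). max (rho y u) (rho x v)) ` far" for x y
    using far_sym by (force simp: max.commute)
  then show ?thesis unfolding dist_far_def by (metis subset_antisym)
qed

text \<open>
  Distance less than 1 to a pair in \<open>far\<close> preserves the codewords at the origin.
\<close>
lemma dist_far_less_1: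
  assumes "x \<in> Full" "y \<in> Full" "dist_far x y < 1"
  shows "x \<in> Bin" "y \<in> Bin" "event x y 0"
proof -
  obtain u v where uv: "(u, v) \<in> far" "rho x u < 1" "rho y v < 1"
    using dist_far_less[OF assms(3)] by blast
  have B: "u \<in> Bin" "v \<in> Bin" using far_Bin[OF uv(1)] by auto
  show "x \<in> Bin" "y \<in> Bin"
    using rho_less_1_Bin(1)[OF assms(1) B(1) uv(2)] rho_less_1_Bin(1)[OF assms(2) B(2) uv(3)] .
  obtain a b where "reads u 0 a" "reads v 0 b" "adj a b"
    using uv(1) unfolding far_def event_def by auto
  moreover have "x (0 + q) = u (0 + q)" "y (0 + q) = v (0 + q)" if "0 \<le> q" "q < 9" for q
    using rho_less_1_Bin(2)[OF assms(1) B(1) uv(2), of q]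
      rho_less_1_Bin(2)[OF assms(2) B(2) uv(3), of q] that by auto
  ultimately show "event x y 0" unfolding event_def by (metis reads_cong)
qed

lemma event_rho:
  assumes "x \<in> Bin" "y \<in> Bin" "event x y 0" shows "rho x y = 1"
proof -
  obtain q where "0 \<le> q" "q < 9" "x q \<noteq> y q" using event_differ[OF assms(3)] by auto
  then show ?thesis using Bin_dist[OF assms(1,2), of q] by (intro rho_core[of q]) auto
qed

lemma met_eq_rho: "x \<in> Full \<Longrightarrow> y \<in> Full \<Longrightarrow> rho x y < 1 \<Longrightarrow> met x y = rho x y"
proof -
  assume *: "x \<in> Full" "y \<in> Full" "rho x y < 1"
  have "\<not> dist_far x y < 1"
    using dist_far_less_1[OF *(1,2)] event_rho[of x y] *(3) by linarith
  then show ?thesis using dist_far_le_1[of x y] by (simp add: met_def)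
qed

lemma rho_le_met: "rho x y \<le> met x y"
  using dist_far_le_1[of x y] by (simp add: met_def)

lemma met_nonneg: "0 \<le> met x y"
  using rho_nonneg rho_le_met order_trans by blast

lemma met_commute: "met x y = met y x"
  by (simp add: met_def rho_commute dist_far_commute)

lemma met_far: "(x, y) \<in> far \<Longrightarrow> met x y = 2"
proof -
  assume "(x, y) \<in> far"
  then have "dist_far x y = 0" using dist_far_le[of x y x y] dist_far_nonneg[of x y] by simp
  moreover have "rho x y = 1"
    using \<open>(x, y) \<in> far\<close> far_Bin by (intro event_rho) (auto simp: far_def)
  ultimately show ?thesis by (simp add: met_def)
qed

lemma dist_far_triangle: "dist_far y z \<le> dist_far x z + rho x y"
proof -
  have "dist_far y z - rho x y \<le> dist_far x z"
    unfolding dist_far_def[of x z]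
  proof (rule cInf_greatest)
    fix c assume "c \<in> insert 1 ((\<lambda>(u, v). max (rho x u) (rho z v)) ` far)"
    then consider "c = 1" | u v where "(u, v) \<in> far" "c = max (rho x u) (rho z v)" by auto
    then show "dist_far y z - rho x y \<le> c"
    proof cases
      case 1
      then show ?thesis using dist_far_le_1[of y z] rho_nonneg[of x y] by linarith
    next
      case 2
      then show ?thesis
        using dist_far_le[of u v y z] rho_triangle[of y u x] rho_commute[of x y] rho_nonneg[of x y]
        by linarith
    qed
  qed simp
  then show ?thesis by simp
qed

text \<open>
  A point \<open>y\<close> close to \<open>x\<close> shows the same codeword at the origin, so \<open>y\<close> and \<open>z\<close> still have
  \<open>rho\<close>-distance 1, and the bump is 1-Lipschitz in its first argument by \<open>dist_far_triangle\<close>.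
\<close>
lemma met_triangle_near:
  assumes "x \<in> Bin" "z \<in> Bin" "y \<in> Full" "event x z 0" "rho x y < 1"
  shows "met x z \<le> met x y + met y z"
proof -
  have y: "y \<in> Bin" and agree: "\<bar>i\<bar> \<le> 9 \<Longrightarrow> y i = x i" for i
    using rho_less_1_Bin(1)[of y x] rho_less_1_Bin(2)[of y x i] assms by (auto simp: rho_commute)
  obtain q where q: "0 \<le> q" "q < 9" "x q \<noteq> z q" using event_differ[OF assms(4)] by auto
  then have "rho y z = 1"
    using Bin_dist[OF y assms(2), of q] agree[of q] by (intro rho_core[of q]) auto
  moreover have "rho x z = 1" by (rule event_rho) (use assms in auto)
  moreover have "met x y = rho x y" using met_eq_rho[of x y] assms by auto
  ultimately show ?thesis using dist_far_triangle[of y z x] by (simp add: met_def)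
qed

text \<open>
  Only pairs with a positive bump need an argument beyond the triangle inequality of \<open>rho\<close>. If one of
  the two steps is short, the previous lemma applies; if not, both have length at least 1, and no distance exceeds 2.
\<close>
lemma met_triangle:
  assumes "x \<in> Full" "y \<in> Full" "z \<in> Full"
  shows "met x z \<le> met x y + met y z"
proof (cases "dist_far x z < 1")
  case False
  then have "met x z = rho x z" using dist_far_le_1[of x z] by (simp add: met_def)
  then show ?thesis using rho_triangle[of x z y] rho_le_met[of x y] rho_le_met[of y z] by linarith
next
  case True
  note far = dist_far_less_1[OF assms(1,3) True]
  consider "rho x y < 1" | "rho y z < 1" | "rho x y = 1" "rho y z = 1"
    using rho_le_1[of x y] rho_le_1[of y z] by linarith
  then show ?thesis
  proof cases
    case 1
    then show ?thesis using met_triangle_near far assms(2) by blast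
  next
    case 2
    then have "met z x \<le> met z y + met y x"
      using far assms(2) by (intro met_triangle_near) (auto simp: rho_commute event_sym)
    then show ?thesis by (simp add: met_commute add.commute)
  next
    case 3
    then show ?thesis
      using rho_le_met[of x y] rho_le_met[of y z] rho_le_1[of x z] dist_far_nonneg[of x z]
      by (simp add: met_def)
  qed
qed

lemma Metric_space_Full: "Metric_space Full met"
proof
  fix x y assume "x \<in> Full" "y \<in> Full"
  then show "met x y = 0 \<longleftrightarrow> x = y"
    using rho_eq_0[of x y] rho_le_met[of x y] rho_nonneg[of x y] met_eq_rho[of x x] by auto
qed (auto simp: met_nonneg met_commute met_triangle)

lemma close_to_finite:
  assumes "finite P" "\<And>r. r0 \<le> r \<Longrightarrow> \<exists>u\<in>P. rho x u < (1/2) ^ r"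
  shows "x \<in> P"
proof (rule ccontr)
  assume "x \<notin> P"
  define d where "d = Min (insert 1 (rho x ` P))"
  have "0 < rho x u" if "u \<in> P" for u
    using rho_eq_0[of x u] rho_nonneg[of x u] that \<open>x \<notin> P\<close> by force
  then have "0 < d" using assms(1) by (simp add: d_def)
  then obtain r where "(1/2) ^ r < d" using real_arch_pow_inv[of d "1/2"] by auto
  then have "(1/2) ^ max r r0 < d"
    using power_decreasing[of r "max r r0" "1/2::real"] by linarith
  moreover obtain u where "u \<in> P" "rho x u < (1/2) ^ max r r0" using assms(2)[of "max r r0"] by auto
  moreover have "d \<le> rho x u" unfolding d_def using assms(1) \<open>u \<in> P\<close> by (intro Min_le) auto
  ultimately show False by simp
qed

text \<open>
  A pair at distance 2 is a limit of pairs in \<open>far\<close>. Levels up to \<open>n\<close> contain finitely many points, so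
  a limit of pairs from these levels stays in them; a limit of pairs from later levels inherits the
  agreement on the past and the event.
\<close>
lemma met_ge_2_cases:
  assumes "x \<in> Full" "y \<in> Full" "2 \<le> met x y"
  shows "x \<in> (\<Union>m\<le>n. level m) \<and> y \<in> (\<Union>m\<le>n. level m) \<or>
         event x y 0 \<and> (\<forall>i. - int (len (Suc n)) \<le> i \<and> i < 0 \<longrightarrow> x i = y i)"
proof (rule disjCI)
  assume neg: "\<not> (event x y 0 \<and> (\<forall>i. - int (len (Suc n)) \<le> i \<and> i < 0 \<longrightarrow> x i = y i))"
  have zero: "dist_far x y \<le> 0" using assms(3) rho_le_1[of x y] by (simp add: met_def)
  then have "dist_far x y < 1" by simp
  note xy = dist_far_less_1[OF assms(1,2) this]
  have *: "\<exists>u v. u \<in> (\<Union>m\<le>n. level m) \<and> v \<in> (\<Union>m\<le>n. level m) \<and> rho x u < (1/2) ^ r \<and> rho y v < (1/2) ^ r"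
    if r: "len (Suc n) \<le> r" for r
  proof -
    have "dist_far x y < (1/2) ^ r" using zero by (rule order_le_less_trans) simp
    then obtain u v where uv: "(u, v) \<in> far" "rho x u < (1/2) ^ r" "rho y v < (1/2) ^ r"
      by (rule dist_far_less) (simp add: power_le_one)
    then obtain m where m: "u \<in> level m" "v \<in> level m"
      "\<forall>i. - int (len m) \<le> i \<and> i < 0 \<longrightarrow> u i = v i" by (auto simp: far_def)
    have "m \<le> n"
    proof (rule ccontr)
      assume "\<not> m \<le> n"
      then have "len (Suc n) \<le> len m" by (intro len_mono) simp
      have "x i = y i" if i: "- int (len (Suc n)) \<le> i" "i < 0" for i
      proof -
        have "x i = u i" by (rule rho_Bin_less[OF xy(1) _ uv(2)]) (use far_Bin uv(1) i r in auto)
        moreover have "y i = v i" by (rule rho_Bin_less[OF xy(2) _ uv(3)]) (use far_Bin uv(1) i r in auto)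
        moreover have "u i = v i" using m(3) i \<open>len (Suc n) \<le> len m\<close> by auto
        ultimately show ?thesis by simp
      qed
      with neg xy(3) show False by blast
    qed
    with m uv show ?thesis by blast
  qed
  have "finite (\<Union>m\<le>n. level m)" by (simp add: finite_level)
  then show "x \<in> (\<Union>m\<le>n. level m) \<and> y \<in> (\<Union>m\<le>n. level m)"
    using * by (intro conjI close_to_finite[where ?r0.0 = "len (Suc n)"]) blast+
qed

section \<open>Compactness and homeomorphisms\<close>

interpretation Full: Metric_space Full met
  by (rule Metric_space_Full)

text \<open>
  Compactness is carried over from the product topology along the identity map.
\<close>
lemma identity_continuous: "continuous_map (top_of_set Full) Full.mtopology (\<lambda>x. x)"
  unfolding Full.continuous_map_to_metric
proof (intro ballI allI impI)
  fix x :: "int \<Rightarrow> real" and e :: real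
  assume "x \<in> topspace (top_of_set Full)" and e: "0 < e"
  then have x: "x \<in> Full" by simp
  obtain m where m: "(1/2) ^ m < min e 1" using real_arch_pow_inv[of "min e 1" "1/2"] e by auto
  define I where "I = {- int (9 + m)..int (9 + m)}"
  define U where "U = (\<Pi>\<^sub>E i\<in>UNIV. if i \<in> I then ball (x i) ((1/2) ^ m) else UNIV)"
  have "openin (product_topology (\<lambda>i. euclidean) UNIV) U"
    unfolding U_def
  proof (rule product_topology_basis)
    have "{i. (if i \<in> I then ball (x i) ((1/2) ^ m) else UNIV) \<noteq> topspace euclidean} \<subseteq> I" by auto
    then show "finite {i. (if i \<in> I then ball (x i) ((1/2) ^ m) else UNIV) \<noteq> topspace euclidean}"
      by (rule finite_subset) (simp add: I_def)
  qed auto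
  then have "open U" by (simp add: euclidean_product_topology)
  moreover have "x \<in> U" by (auto simp: U_def)
  moreover have "y \<in> Full.mball x e" if y: "y \<in> Full" "y \<in> U" for y
  proof -
    have "\<bar>x i - y i\<bar> \<le> (1/2) ^ m" if "\<bar>i\<bar> \<le> int (9 + m)" for i
    proof -
      have "i \<in> I" using that by (auto simp: I_def)
      then have "y i \<in> ball (x i) ((1/2) ^ m)"
        using y(2) unfolding U_def by (auto dest: PiE_mem[of _ _ _ i])
      then show ?thesis by (simp add: dist_real_def)
    qed
    then have "rho x y \<le> (1/2) ^ m" by (rule rho_le_window) auto
    then show ?thesis using m x y(1) met_eq_rho[of x y] by simp
  qed
  ultimately show "\<exists>U. openin (top_of_set Full) U \<and> x \<in> U \<and> (\<forall>y\<in>U. y \<in> Full.mball x e)"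
    using x by (intro exI[of _ "Full \<inter> U"]) (auto simp: openin_open)
qed

lemma compact_Bin: "compact Bin" and compact_Thick: "compact Thick"
proof -
  have *: "compact (\<Pi>\<^sub>E i\<in>(UNIV :: int set). S)" if "compact S" for S :: "real set"
    using that compactin_PiE[of "\<lambda>i. euclidean" UNIV "\<lambda>i. S"]
    by (simp add: euclidean_product_topology)
  have "Bin = (\<Pi>\<^sub>E i\<in>UNIV. {0, 1})" "Thick = (\<Pi>\<^sub>E i\<in>UNIV. {2..3})"
    by (auto simp: Bin_def Thick_def)
  then show "compact Bin" "compact Thick" using *[of "{0, 1}"] *[of "{2..3}"] by auto
qed

lemma compactin_Full: "compactin Full.mtopology Full" and compactin_Bin: "compactin Full.mtopology Bin"
proof -
  have "compactin Full.mtopology ((\<lambda>x. x) ` S)" if "compact S" "S \<subseteq> Full" for S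
    by (rule image_compactin[OF _ identity_continuous]) (use that in \<open>simp add: compactin_subtopology\<close>)
  then show "compactin Full.mtopology Full" "compactin Full.mtopology Bin"
    using compact_Bin compact_Thick by (auto intro: compact_Un)
qed

text \<open>
  The bump is discarded first: it does not contribute at points with small \<open>rho\<close>-distance.
\<close>
lemma continuous_map_if_rho:
  assumes "f ` Full \<subseteq> Full" "\<And>x y. rho (f x) (f y) \<le> 2 * rho x y"
  shows "continuous_map Full.mtopology Full.mtopology f"
proof -
  have *: "\<exists>d>0. \<forall>y. y \<in> Full \<and> met x y < d \<longrightarrow> met (f x) (f y) < e" if "x \<in> Full" "e > 0" for x e
  proof (intro exI conjI allI impI)
    show "0 < min e 1 / 2" using that by simp
    fix y assume y: "y \<in> Full \<and> met x y < min e 1 / 2"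
    then have r: "rho (f x) (f y) < min e 1" using rho_le_met[of x y] assms(2)[of x y] by linarith
    have "f x \<in> Full" "f y \<in> Full" using assms(1) that(1) y by blast+
    then show "met (f x) (f y) < e" using met_eq_rho[of "f x" "f y"] r by simp
  qed
  show ?thesis
    unfolding Full.metric_continuous_map[OF Metric_space_Full]
    by (intro conjI ballI allI impI assms(1)) (rule *)
qed

lemma homeomorphic_shift: "homeomorphic_map Full.mtopology Full.mtopology shift"
  unfolding homeomorphic_map_maps
proof
  have "(\<lambda>i. x (i - 1)) \<in> Full" if "x \<in> Full" for x
    using that by (auto simp: Bin_def Thick_def)
  moreover have "shift x \<in> Full" if "x \<in> Full" for x
    using that by (simp add: shift_Bin shift_Thick)
  ultimately show "homeomorphic_maps Full.mtopology Full.mtopology shift (\<lambda>x i. x (i - 1))"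
    unfolding homeomorphic_maps_def using rho_shift rho_unshift
    by (intro conjI continuous_map_if_rho image_subsetI) (simp_all add: shift_def)
qed

lemma shift_image_Bin: "shift ` Bin = Bin"
proof -
  have "x \<in> shift ` Bin" if "x \<in> Bin" for x
    using that by (intro image_eqI[of _ _ "\<lambda>i. x (i - 1)"]) (auto simp: Bin_def shift_def)
  then show ?thesis using shift_Bin by blast
qed

lemma homeomorphic_shift_Bin:
  "homeomorphic_map (subtopology Full.mtopology Bin) (subtopology Full.mtopology Bin) shift"
  by (rule homeomorphic_map_subtopologies[OF homeomorphic_shift])
     (auto simp: Int_absorb1 shift_image_Bin)

section \<open>Spanning and separated numbers\<close>

lemma bowen_less: "0 < T \<Longrightarrow>
    bowen_metric d F T x y < c \<longleftrightarrow> (\<forall>t<T. d ((F ^^ t) x) ((F ^^ t) y) < c)"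
  unfolding bowen_metric_def by (subst Max_less_iff) auto

lemma bowen_ge: "0 < T \<Longrightarrow>
    c \<le> bowen_metric d F T x y \<longleftrightarrow> (\<exists>t<T. c \<le> d ((F ^^ t) x) ((F ^^ t) y))"
  unfolding bowen_metric_def by (subst Max_ge_iff) auto

lemma span_number_le: "finite S \<Longrightarrow> eps_spanning \<mu> \<epsilon> Y S \<Longrightarrow> span_number Y \<epsilon> \<mu> \<le> card S"
  unfolding span_number_def by (rule Least_le) blast

lemma span_number_ge:
  assumes "finite S" "eps_spanning \<mu> \<epsilon> Y S"
    and "\<And>S. finite S \<Longrightarrow> eps_spanning \<mu> \<epsilon> Y S \<Longrightarrow> c \<le> card S"
  shows "c \<le> span_number Y \<epsilon> \<mu>"
proof -
  have "\<exists>S. finite S \<and> eps_spanning \<mu> \<epsilon> Y S \<and> card S = span_number Y \<epsilon> \<mu>"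
    unfolding span_number_def by (rule LeastI_ex) (use assms(1,2) in blast)
  then show ?thesis using assms(3) by metis
qed

lemma sep_number_le:
  assumes "\<And>S. finite S \<Longrightarrow> S \<subseteq> Y \<Longrightarrow> eps_separated \<mu> \<epsilon> S \<Longrightarrow> card S \<le> N"
  shows "sep_number Y \<epsilon> \<mu> \<le> N"
proof -
  have "\<exists>S. finite S \<and> S \<subseteq> Y \<and> eps_separated \<mu> \<epsilon> S \<and> card S = sep_number Y \<epsilon> \<mu>"
    unfolding sep_number_def
  proof (rule GreatestI_nat[where k = 0 and b = N])
    show "\<exists>S. finite S \<and> S \<subseteq> Y \<and> eps_separated \<mu> \<epsilon> S \<and> card S = 0"
      by (intro exI[of _ "{}"]) (simp add: eps_separated_def)
  qed (use assms in blast)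
  then show ?thesis using assms by metis
qed

lemma sep_number_ge:
  assumes "\<And>S. finite S \<Longrightarrow> S \<subseteq> Y \<Longrightarrow> eps_separated \<mu> \<epsilon> S \<Longrightarrow> card S \<le> N"
    and "finite S" "S \<subseteq> Y" "eps_separated \<mu> \<epsilon> S"
  shows "card S \<le> sep_number Y \<epsilon> \<mu>"
  unfolding sep_number_def by (rule Greatest_le_nat[where b = N]) (use assms in blast)+

section \<open>Spanning rates of the binary sequences\<close>

text \<open>
  Binary words at the positions from \<open>a\<close> to \<open>b - 1\<close>, continued by zeros.
\<close>
definition blocks :: "int \<Rightarrow> int \<Rightarrow> (int \<Rightarrow> real) set" where
  "blocks a b = indicator ` Pow {a..<b}"

lemma finite_blocks: "finite (blocks a b)"
  by (simp add: blocks_def)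

lemma card_blocks: "card (blocks a b) = 2 ^ nat (b - a)"
proof -
  have "inj_on (indicator :: int set \<Rightarrow> int \<Rightarrow> real) (Pow {a..<b})"
    by (rule inj_onI) (metis indicator_eq_1_iff subset_antisym subsetI)
  then show ?thesis by (simp add: blocks_def card_image card_Pow)
qed

lemma blocks_Bin: "blocks a b \<subseteq> Bin"
  by (auto simp: blocks_def Bin_def indicator_def)

lemma blocks_truncate:
  assumes "x \<in> Bin"
  obtains s where "s \<in> blocks a b" "\<And>i. a \<le> i \<Longrightarrow> i < b \<Longrightarrow> s i = x i"
proof
  show "indicator {i \<in> {a..<b}. x i = 1} \<in> blocks a b" unfolding blocks_def by blast
  show "indicator {i \<in> {a..<b}. x i = 1} i = x i" if "a \<le> i" "i < b" for i
    using assms that by (force simp: Bin_def indicator_def)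
qed

lemma blocks_eqI:
  assumes "x \<in> blocks a b" "y \<in> blocks a b" "\<And>i. a \<le> i \<Longrightarrow> i < b \<Longrightarrow> x i = y i"
  shows "x = y"
proof
  fix i
  show "x i = y i"
  proof (cases "a \<le> i \<and> i < b")
    case False
    then have "z i = 0" if "z \<in> blocks a b" for z
      using that by (force simp: blocks_def)
    from this[OF assms(1)] this[OF assms(2)] show ?thesis by simp
  qed (use assms(3) in blast)
qed

lemma met_less_1_Bin:
  assumes "x \<in> Bin" "y \<in> Bin" "met x y < 1" shows "x 0 = y 0"
  using rho_Bin_less[of x y 0 0] rho_le_met[of x y] assms by simp

text \<open>
  At scales up to 1, a point determines the symbols at times below \<open>T\<close> of every point that it spans,
  so a spanning set realises all binary words of length \<open>T\<close>.
\<close>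
lemma span_Bin_lower:
  assumes "0 < T" "\<delta> \<le> 1" "finite S" "eps_spanning (bowen_metric met shift T) \<delta> Bin S"
  shows "2 ^ T \<le> card S"
proof -
  define f :: "(int \<Rightarrow> real) \<Rightarrow> int \<Rightarrow> real" where "f s = indicator {i \<in> {0..<int T}. s i = 1}" for s
  have "y \<in> f ` S" if y: "y \<in> blocks 0 (int T)" for y
  proof -
    have B: "y \<in> Bin" using blocks_Bin y by blast
    then obtain s where s: "s \<in> S" "s \<in> Bin" "bowen_metric met shift T s y < \<delta>"
      using assms(4) unfolding eps_spanning_def by blast
    have eq: "s (int t) = y (int t)" if "t < T" for t
    proof -
      have "met ((shift ^^ t) s) ((shift ^^ t) y) < 1"
        using s(3) that assms(1,2) by (force simp: bowen_less)
      then have "((shift ^^ t) s) 0 = ((shift ^^ t) y) 0"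
        by (intro met_less_1_Bin) (simp_all only: shift_funpow_Bin s(2) B)
      then show ?thesis by (simp add: shift_funpow)
    qed
    have "y = f s"
    proof (rule blocks_eqI[OF y])
      show "f s \<in> blocks 0 (int T)" unfolding f_def blocks_def by blast
      fix i assume i: "0 \<le> i" "i < int T"
      then have "s i = y i" using eq[of "nat i"] by simp
      then show "y i = f s i" using B i by (force simp: f_def Bin_def indicator_def)
    qed
    then show ?thesis using s(1) by blast
  qed
  then have "card (blocks 0 (int T)) \<le> card (f ` S)"
    using assms(3) by (intro card_mono) auto
  also have "\<dots> \<le> card S" by (rule card_image_le[OF assms(3)])
  finally show ?thesis by (simp add: card_blocks)
qed

text \<open>
  Beyond a fixed number of positions on either side of the window, symbols do not matter at a given scale.
\<close>
lemma blocks_spanning: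
  assumes "0 < T" "(1/2) ^ m < min \<delta> 1"
  shows "eps_spanning (bowen_metric met shift T) \<delta> Bin (blocks (- int (9 + m)) (int (T + 9 + m)))"
  unfolding eps_spanning_def
proof (intro conjI ballI blocks_Bin)
  fix y assume y: "y \<in> Bin"
  obtain s where s: "s \<in> blocks (- int (9 + m)) (int (T + 9 + m))"
    "\<And>i. - int (9 + m) \<le> i \<Longrightarrow> i < int (T + 9 + m) \<Longrightarrow> s i = y i"
    using blocks_truncate[OF y] by blast
  have "met ((shift ^^ t) s) ((shift ^^ t) y) < \<delta>" if "t < T" for t
  proof -
    have "rho ((shift ^^ t) s) ((shift ^^ t) y) \<le> (1/2) ^ m"
    proof (rule rho_le_window)
      fix i :: int assume "\<bar>i\<bar> \<le> int (9 + m)"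
      then have "s (i + int t) = y (i + int t)" using that by (intro s(2)) auto
      then show "\<bar>(shift ^^ t) s i - (shift ^^ t) y i\<bar> \<le> (1/2) ^ m" by (simp add: shift_funpow)
    qed simp
    moreover have "(shift ^^ t) s \<in> Full" "(shift ^^ t) y \<in> Full"
      using s(1) y blocks_Bin shift_funpow_Bin by blast+
    ultimately show ?thesis using met_eq_rho[of "(shift ^^ t) s" "(shift ^^ t) y"] assms(2) by simp
  qed
  then show "\<exists>s\<in>blocks (- int (9 + m)) (int (T + 9 + m)). bowen_metric met shift T s y < \<delta>"
    using s(1) assms(1) by (auto simp: bowen_less)
qed

lemma span_rate_Bin_small:
  assumes "0 < \<delta>" "\<delta> \<le> 1" shows "span_rate Bin met shift \<delta> \<longlonglongrightarrow> ln 2"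
proof -
  obtain m where m: "(1/2) ^ m < min \<delta> 1"
    using real_arch_pow_inv[of "min \<delta> 1" "1/2"] assms(1) by auto
  have bounds: "ln 2 \<le> span_rate Bin met shift \<delta> T \<and>
      span_rate Bin met shift \<delta> T \<le> ln 2 * (1 + real (18 + 2 * m) / real T)" if "0 < T" for T
  proof -
    define n where "n = span_number Bin \<delta> (bowen_metric met shift T)"
    note sp = blocks_spanning[OF that m]
    have "2 ^ T \<le> n"
      unfolding n_def by (rule span_number_ge[OF finite_blocks sp]) (rule span_Bin_lower[OF that assms(2)])
    then have lo: "(2::real) ^ T \<le> real n" by (metis of_nat_le_iff of_nat_numeral of_nat_power)
    have "n \<le> 2 ^ nat (int (T + 9 + m) + int (9 + m))"
      using span_number_le[OF finite_blocks sp] by (simp add: n_def card_blocks)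
    also have "nat (int (T + 9 + m) + int (9 + m)) = T + (18 + 2 * m)" by simp
    finally have hi: "real n \<le> (2::real) ^ (T + (18 + 2 * m))" by (metis of_nat_le_iff of_nat_numeral of_nat_power)
    have "0 < real n" using lo by (rule less_le_trans[rotated]) simp
    have "real T * ln 2 \<le> ln (real n)" using ln_mono[OF lo] by (simp add: ln_realpow)
    moreover have "ln (real n) \<le> (real T + real (18 + 2 * m)) * ln 2"
      using ln_mono[OF hi \<open>0 < real n\<close>] by (simp add: ln_realpow)
    ultimately show ?thesis using that
      by (simp add: span_rate_def n_def[symmetric] field_simps)
  qed
  show ?thesis
  proof (rule tendsto_sandwich)
    show "\<forall>\<^sub>F T in sequentially. ln 2 \<le> span_rate Bin met shift \<delta> T"
      "\<forall>\<^sub>F T in sequentially. span_rate Bin met shift \<delta> T \<le> ln 2 * (1 + real (18 + 2 * m) / real T)"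
      using bounds by (auto intro: eventually_mono[OF eventually_gt_at_top[of 0]])
    have "(\<lambda>T. ln 2 * (1 + real (18 + 2 * m) / real T)) \<longlonglongrightarrow> ln 2 * (1 + 0)"
      by (intro tendsto_intros lim_const_over_n)
    then show "(\<lambda>T. ln 2 * (1 + real (18 + 2 * m) / real T)) \<longlonglongrightarrow> ln 2" by simp
  qed simp
qed

text \<open>
  The zero sequence shows no codeword and hence no bump.
\<close>
lemma met_zero_le_1:
  assumes "y \<in> Full" shows "met (\<lambda>_. 0) y \<le> 1"
proof -
  have z: "(\<lambda>_. 0) \<in> Full" by (simp add: Bin_def)
  have "\<not> event (\<lambda>_. 0) y 0" by (force simp: event_def reads_def code_def)
  then have "\<not> dist_far (\<lambda>_. 0) y < 1" using dist_far_less_1(3)[OF z assms] by blast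
  then show ?thesis using rho_le_1[of "\<lambda>_. 0" y] by (simp add: met_def)
qed

lemma span_rate_large:
  assumes "Bin \<subseteq> Y" "Y \<subseteq> Full" "1 < \<delta>" shows "span_rate Y met shift \<delta> \<longlonglongrightarrow> 0"
proof -
  have "span_rate Y met shift \<delta> T = 0" if "0 < T" for T
  proof -
    have z: "(\<lambda>_. 0) \<in> Y" using assms(1) by (auto simp: Bin_def)
    have sp: "eps_spanning (bowen_metric met shift T) \<delta> Y {\<lambda>_. 0}"
      unfolding eps_spanning_def
    proof (intro conjI ballI)
      fix y assume y: "y \<in> Y"
      have "met ((shift ^^ t) (\<lambda>_. 0)) ((shift ^^ t) y) < \<delta>" for t
      proof -
        have "(shift ^^ t) y \<in> Full"
          using y assms(2) shift_funpow_Bin[of t y] shift_funpow_Thick[of t y] by blast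
        moreover have "(shift ^^ t) (\<lambda>_. 0) = (\<lambda>_. 0)" by (simp add: shift_funpow)
        ultimately show ?thesis using met_zero_le_1[of "(shift ^^ t) y"] assms(3) by simp
      qed
      then show "\<exists>s\<in>{\<lambda>_. 0}. bowen_metric met shift T s y < \<delta>" using that by (simp add: bowen_less)
    qed (use z in simp)
    have "1 \<le> card S" if "finite S" "eps_spanning (bowen_metric met shift T) \<delta> Y S" for S
      using that z unfolding eps_spanning_def by (metis One_nat_def Suc_leI card_gt_0_iff empty_iff)
    then have "1 \<le> span_number Y \<delta> (bowen_metric met shift T)"
      by (intro span_number_ge[OF _ sp]) auto
    moreover have "span_number Y \<delta> (bowen_metric met shift T) \<le> 1"
      using span_number_le[OF _ sp] by simp
    ultimately show ?thesis by (simp add: span_rate_def)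
  qed
  then have "\<forall>\<^sub>F T in sequentially. span_rate Y met shift \<delta> T = 0"
    by (auto intro: eventually_mono[OF eventually_gt_at_top[of 0]])
  then show ?thesis by (rule tendsto_eventually)
qed

section \<open>Entropies\<close>

lemma top_entropy_Bin: "top_entropy Bin met shift = ereal (ln 2)"
proof -
  have "limsup (\<lambda>T. ereal (span_rate Bin met shift \<delta> T)) = ereal (ln 2)" if "0 < \<delta>" "\<delta> \<le> 1" for \<delta>
    using span_rate_Bin_small[OF that] by (intro lim_imp_Limsup) auto
  then have "\<forall>\<^sub>F \<delta> in at_right 0. limsup (\<lambda>T. ereal (span_rate Bin met shift \<delta> T)) = ereal (ln 2)"
    unfolding eventually_at_right_field by (intro exI[of _ 1]) auto
  then show ?thesis unfolding top_entropy_def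
    by (intro tendsto_Lim tendsto_eventually) auto
qed

text \<open>
  The shift at most doubles \<open>rho\<close>, so a finite net for the metric at a scale smaller by the factor
  \<open>2 ^ T\<close> is spanning for the Bowen metric.
\<close>
lemma finite_spanning_Full:
  assumes "0 < \<delta>" "0 < T"
  obtains S where "finite S" "eps_spanning (bowen_metric met shift T) \<delta> Full S"
proof -
  define r where "r = min \<delta> 1 / 2 ^ T"
  have "0 < r" using assms(1) by (simp add: r_def)
  have "Full.mtotally_bounded Full"
    by (rule Full.compactin_imp_mtotally_bounded[OF compactin_Full])
  from this[unfolded Full.mtotally_bounded_def, rule_format, OF \<open>0 < r\<close>]
  obtain S where "finite S \<and> S \<subseteq> Full \<and> Full \<subseteq> (\<Union>x\<in>S. Full.mball x r)" ..
  then have S: "finite S" "S \<subseteq> Full" "Full \<subseteq> (\<Union>x\<in>S. Full.mball x r)" by simp_all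
  have "\<exists>s\<in>S. bowen_metric met shift T s y < \<delta>" if y: "y \<in> Full" for y
  proof -
    obtain s where s: "s \<in> S" "s \<in> Full" "met s y < r" using S(3) y by auto
    have "met ((shift ^^ t) s) ((shift ^^ t) y) < \<delta>" if "t < T" for t
    proof -
      have "rho ((shift ^^ t) s) ((shift ^^ t) y) \<le> 2 ^ t * rho s y" by (rule rho_shift_funpow)
      also have "\<dots> \<le> 2 ^ T * rho s y"
        using that rho_nonneg by (intro mult_right_mono power_increasing) auto
      also have "\<dots> < 2 ^ T * r" using s(3) rho_le_met[of s y] by simp
      also have "\<dots> = min \<delta> 1" by (simp add: r_def)
      finally have "rho ((shift ^^ t) s) ((shift ^^ t) y) < min \<delta> 1" .
      moreover have "(shift ^^ t) s \<in> Full" "(shift ^^ t) y \<in> Full"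
        using s(2) y shift_funpow_Bin shift_funpow_Thick by blast+
      ultimately show ?thesis using met_eq_rho[of "(shift ^^ t) s" "(shift ^^ t) y"] by simp
    qed
    then show ?thesis using s(1) assms(2) by (auto simp: bowen_less)
  qed
  then show ?thesis using S by (intro that[of S]) (auto simp: eps_spanning_def)
qed

text \<open>
  The thick sequences with values in the grid of step \<open>1/K\<close> at times below \<open>T\<close> need different
  spanning points, because half a step is at least \<open>\<delta>\<close>.
\<close>
lemma span_Full_lower:
  assumes "0 < T" "0 < K" "\<delta> \<le> 1 / (2 * real K)" "finite S"
    and "eps_spanning (bowen_metric met shift T) \<delta> Full S"
  shows "K ^ T \<le> card S"
proof -
  define W where "W = ({0..<int T} \<rightarrow>\<^sub>E {..<K})"
  define g where "g w i = (if i \<in> {0..<int T} then 2 + real (w i) / real K else 2)" for w :: "int \<Rightarrow> nat" and i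
  have thick: "g w \<in> Thick" if "w \<in> W" for w
  proof -
    have "w i < K" if "i \<in> {0..<int T}" for i 
      using PiE_mem[OF \<open>w \<in> W\<close>[unfolded W_def] that] by simp
    then have "real (w i) / real K \<le> 1" if "i \<in> {0..<int T}" for i
      using that assms(2) by (simp add: less_imp_le)
    then show ?thesis by (auto simp: Thick_def g_def)
  qed
  have "\<exists>s\<in>S. bowen_metric met shift T s (g w) < \<delta>" if "w \<in> W" for w
    using assms(5) thick[OF that] unfolding eps_spanning_def by blast
  then obtain c where c: "\<And>w. w \<in> W \<Longrightarrow> c w \<in> S \<and> bowen_metric met shift T (c w) (g w) < \<delta>"
    by metis
  have half: "1 / (2 * real K) \<le> 1 / 2" using assms(2) by simp
  have close: "\<bar>c w i - g w i\<bar> < \<delta>" if "w \<in> W" "i \<in> {0..<int T}" for w i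
  proof -
    have "met ((shift ^^ nat i) (c w)) ((shift ^^ nat i) (g w)) < \<delta>"
      using c[OF that(1)] that(2) assms(1) by (auto simp: bowen_less)
    then have "rho ((shift ^^ nat i) (c w)) ((shift ^^ nat i) (g w)) < \<delta>"
      using rho_le_met order_le_less_trans by blast
    then have "min 1 \<bar>c w i - g w i\<bar> < \<delta>"
      using rho_term_le[of 0 "(shift ^^ nat i) (c w)" "(shift ^^ nat i) (g w)"] that(2)
      by (simp add: shift_funpow weight_core)
    then show ?thesis using assms(3) half by linarith
  qed
  have "inj_on c W"
  proof (rule inj_onI)
    fix v w assume vw: "v \<in> W" "w \<in> W" "c v = c w"
    show "v = w"
    proof (rule PiE_ext[OF vw(1,2)[unfolded W_def]])
      fix i assume i: "i \<in> {0..<int T}"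
      have "\<bar>g v i - g w i\<bar> < 2 * \<delta>" 
        using close[OF vw(1) i] close[OF vw(2) i] fun_cong[OF vw(3), of i] by linarith
      also have "\<dots> \<le> 1 / real K" using assms(3) by (simp add: field_simps)
      finally have "\<bar>real (v i) / real K - real (w i) / real K\<bar> < 1 / real K"
        using i by (simp add: g_def)
      then have "\<bar>real (v i) - real (w i)\<bar> / real K < 1 / real K"
        by (metis abs_divide abs_of_nat diff_divide_distrib)
      then have "\<bar>real (v i) - real (w i)\<bar> < 1" using assms(2) by (simp add: divide_less_cancel)
      then show "v i = w i" by linarith
    qed
  qed
  then have "card W \<le> card S" using c assms(4) by (intro card_inj_on_le[of c]) auto
  then show ?thesis by (simp add: W_def card_PiE)
qed

lemma top_entropy_Full: "top_entropy Full met shift = \<infinity>"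
proof -
  have limsup_ge: "ereal (ln (real K)) \<le> limsup (\<lambda>T. ereal (span_rate Full met shift \<delta> T))"
    if "0 < K" "0 < \<delta>" "\<delta> \<le> 1 / (2 * real K)" for K \<delta>
  proof (rule le_Limsup)
    have "ln (real K) \<le> span_rate Full met shift \<delta> T" if "0 < T" for T
    proof -
      obtain S where S: "finite S" "eps_spanning (bowen_metric met shift T) \<delta> Full S"
        using finite_spanning_Full[OF \<open>0 < \<delta>\<close> \<open>0 < T\<close>] .
      have "K ^ T \<le> span_number Full \<delta> (bowen_metric met shift T)"
        by (rule span_number_ge[OF S]) (rule span_Full_lower[OF \<open>0 < T\<close> \<open>0 < K\<close> \<open>\<delta> \<le> _\<close>])
      then have "real K ^ T \<le> real (span_number Full \<delta> (bowen_metric met shift T))"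
        by (metis of_nat_le_iff of_nat_power)
      from ln_mono[OF this] show ?thesis
        using \<open>0 < K\<close> \<open>0 < T\<close> by (simp add: span_rate_def ln_realpow field_simps)
    qed
    then show "\<forall>\<^sub>F T in sequentially. ereal (ln (real K)) \<le> ereal (span_rate Full met shift \<delta> T)"
      by (auto intro: eventually_mono[OF eventually_gt_at_top[of 0]])
  qed simp
  have "((\<lambda>\<delta>. limsup (\<lambda>T. ereal (span_rate Full met shift \<delta> T))) \<longlongrightarrow> \<infinity>) (at_right 0)"
    unfolding tendsto_PInfty
  proof
    fix r :: real
    obtain K :: nat where K: "exp r < real K" using reals_Archimedean2 by blast
    have "0 < real K" using K exp_gt_zero[of r] by linarith
    then have "r < ln (real K)" using K by (metis ln_exp ln_less_cancel_iff exp_gt_zero)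
    have "ereal r < limsup (\<lambda>T. ereal (span_rate Full met shift \<delta> T))"
      if "0 < \<delta>" "\<delta> < 1 / (2 * real K)" for \<delta>
    proof -
      have "ereal r < ereal (ln (real K))" using \<open>r < ln (real K)\<close> by simp
      also have "\<dots> \<le> limsup (\<lambda>T. ereal (span_rate Full met shift \<delta> T))"
        using \<open>0 < real K\<close> that by (intro limsup_ge) auto
      finally show ?thesis .
    qed
    then show "\<forall>\<^sub>F \<delta> in at_right 0. ereal r < limsup (\<lambda>T. ereal (span_rate Full met shift \<delta> T))"
      unfolding eventually_at_right_field using \<open>0 < real K\<close>
      by (intro exI[of _ "1 / (2 * real K)"]) auto
  qed
  then show ?thesis unfolding top_entropy_def by (intro tendsto_Lim) auto
qed

section \<open>Separated numbers at scale two\<close>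

lemma met_ge_2_Bin:
  assumes "x \<in> Full" "y \<in> Full" "2 \<le> met x y" shows "x \<in> Bin" "y \<in> Bin"
proof -
  have "dist_far x y < 1" using assms(3) rho_le_1[of x y] by (simp add: met_def)
  then show "x \<in> Bin" "y \<in> Bin" using dist_far_less_1[OF assms(1,2)] by auto
qed

lemma separated_Full:
  assumes "0 < T" "S \<subseteq> Full" "eps_separated (bowen_metric met shift T) 2 S" "2 \<le> card S"
  shows "S \<subseteq> Bin"
proof
  fix x assume x: "x \<in> S"
  have "\<not> S \<subseteq> {x}"
    using card_mono[of "{x}" S] assms(4) by auto
  then obtain y where y: "y \<in> S" "x \<noteq> y" by blast
  then obtain t where "2 \<le> met ((shift ^^ t) x) ((shift ^^ t) y)"
    using assms(1,3) x unfolding eps_separated_def by (auto simp: bowen_ge)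
  moreover have "(shift ^^ t) x \<in> Full" "(shift ^^ t) y \<in> Full"
    using x y(1) assms(2) shift_funpow_Bin shift_funpow_Thick by blast+
  ultimately have "(shift ^^ t) x \<in> Bin" using met_ge_2_Bin by blast
  then show "x \<in> Bin" by (simp only: shift_funpow_Bin)
qed

text \<open>
  Distance 2 occurs only inside \<open>Bin\<close>; sets with at most one element can be replaced by subsets of \<open>Bin\<close>.
\<close>
lemma sep_number_Full:
  assumes "0 < T"
  shows "sep_number Full 2 (bowen_metric met shift T) = sep_number Bin 2 (bowen_metric met shift T)"
proof -
  have "(\<exists>S. finite S \<and> S \<subseteq> Full \<and> eps_separated (bowen_metric met shift T) 2 S \<and> card S = n) \<longleftrightarrow>
        (\<exists>S. finite S \<and> S \<subseteq> Bin \<and> eps_separated (bowen_metric met shift T) 2 S \<and> card S = n)" (is "?L \<longleftrightarrow> ?R") for n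
  proof
    assume ?L
    then obtain S where S: "finite S" "S \<subseteq> Full" "eps_separated (bowen_metric met shift T) 2 S" "card S = n"
      by metis
    show ?R
    proof (cases "2 \<le> n")
      case True
      then show ?R using separated_Full[OF assms S(2,3)] S by metis
    next
      case False
      have z: "(\<lambda>_. 0) \<in> Bin" by (simp add: Bin_def)
      from False have "n = 0 \<or> n = 1" by linarith
      then show ?R
      proof
        assume "n = 0"
        then show ?R by (intro exI[of _ "{}"]) (simp add: eps_separated_def)
      next
        assume "n = 1"
        then show ?R using z by (intro exI[of _ "{\<lambda>_. 0}"]) (simp add: eps_separated_def)
      qed
    qed
  next
    assume ?R then show ?L by (metis le_supI1)
  qed
  then show ?thesis unfolding sep_number_def by simp
qed

text \<open>
  Points whose orbit meets a level up to \<open>n\<close> during the window form the finite set \<open>B\<close>. Any two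
  other points of \<open>S\<close> are separated by an event before which they agree on the whole window, so the
  tree bound applies to them.
\<close>
lemma sep_upper:
  assumes "finite S" "S \<subseteq> Bin" and T: "0 < T" "T \<le> len (Suc n)" "T \<le> 9 * k"
    and sep: "eps_separated (bowen_metric met shift T) 2 S"
  shows "card S \<le> T * (Suc n * (19 * len n * 5 ^ len n)) + 2 ^ k"
proof -
  define P where "P = (\<Union>m\<le>n. level m)"
  define B where "B = (\<Union>t<T. (\<lambda>x i. x (i - int t)) ` P)"
  have finP: "finite P" by (simp add: P_def finite_level)
  have "card P \<le> (\<Sum>m\<le>n. card (level m))" unfolding P_def by (rule card_UN_le) simp
  also have "\<dots> \<le> (\<Sum>m\<le>n. 19 * len n * 5 ^ len n)"
  proof (rule sum_mono)
    fix m assume "m \<in> {..n}"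
    then have "len m \<le> len n" by (intro len_mono) simp
    then have "19 * len m * 5 ^ len m \<le> 19 * len n * 5 ^ len n"
      by (intro mult_mono power_increasing) auto
    with card_level[of m] show "card (level m) \<le> 19 * len n * 5 ^ len n" by (rule order_trans)
  qed
  finally have cardP: "card P \<le> Suc n * (19 * len n * 5 ^ len n)" by simp
  have "card B \<le> (\<Sum>t<T. card ((\<lambda>x i. x (i - int t)) ` P))" unfolding B_def by (rule card_UN_le) simp
  also have "\<dots> \<le> (\<Sum>t<T. card P)" by (intro sum_mono card_image_le finP)
  also have "\<dots> \<le> T * (Suc n * (19 * len n * 5 ^ len n))" using cardP by simp
  finally have cardB: "card B \<le> T * (Suc n * (19 * len n * 5 ^ len n))" .
  have finB: "finite B" by (simp add: B_def finP)
  have "event_within 0 (0 + 9 * int k) x y" if xy: "x \<in> S - B" "y \<in> S - B" "x \<noteq> y" for x y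
  proof -
    obtain t where t: "t < T" "2 \<le> met ((shift ^^ t) x) ((shift ^^ t) y)"
      using sep xy T(1) unfolding eps_separated_def by (auto simp: bowen_ge)
    have "(shift ^^ t) x \<in> Full" "(shift ^^ t) y \<in> Full"
      using xy(1,2) assms(2) shift_funpow_Bin by blast+
    moreover have "(shift ^^ t) x \<notin> P"
    proof
      assume "(shift ^^ t) x \<in> P"
      then have "(\<lambda>i. ((shift ^^ t) x) (i - int t)) \<in> B" unfolding B_def using t(1) by blast
      then show False using xy(1) by (simp add: shift_funpow)
    qed
    ultimately have ev: "event ((shift ^^ t) x) ((shift ^^ t) y) 0"
      and agree: "\<forall>i. - int (len (Suc n)) \<le> i \<and> i < 0 \<longrightarrow> (shift ^^ t) x i = (shift ^^ t) y i"
      using met_ge_2_cases[of "(shift ^^ t) x" "(shift ^^ t) y" n] t(2) unfolding P_def by blast+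
    have "x i = y i" if "0 \<le> i" "i < int t" for i
      using agree[rule_format, of "i - int t"] that t(1) T(2) by (simp add: shift_funpow)
    moreover have "event x y (int t)"
      using ev by (simp add: event_def reads_def shift_funpow add.commute)
    ultimately show ?thesis
      unfolding event_within_def using t(1) T(3) by (intro exI[of _ "int t"]) auto
  qed
  then have "card (S - B) \<le> 2 ^ k" using assms(1) by (intro event_within_card[where s = 0]) auto
  moreover have "card S \<le> card B + card (S - B)"
    using card_Un_le[of B "S - B"] card_mono[of "B \<union> S" S] assms(1) finB by simp
  ultimately show ?thesis using cardB by linarith
qed

text \<open>
  The signals of level \<open>n\<close> are separated. The coarse instance of \<open>sep_upper\<close> provides the boundedness that
  makes the greatest cardinality meaningful.
\<close>
lemma sep_lower: "5 ^ len n \<le> sep_number Bin 2 (bowen_metric met shift (19 * len n))"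
proof -
  have T: "0 < 19 * len n" by simp
  have bound: "card S \<le> 19 * len n * (Suc (19 * len n) * (19 * len (19 * len n) * 5 ^ len (19 * len n))) + 2 ^ (19 * len n)"
    if "finite S" "S \<subseteq> Bin" "eps_separated (bowen_metric met shift (19 * len n)) 2 S" for S
  proof (rule sep_upper[OF that(1,2) T _ _ that(3)])
    have "19 * len n < 36 ^ (19 * len n)" by (rule less_exp[THEN less_le_trans]) (simp add: power_mono)
    also have "\<dots> \<le> len (Suc (19 * len n))" by (simp add: len_def)
    finally show "19 * len n \<le> len (Suc (19 * len n))" by simp
  qed simp
  have "card (signal n ` messages n) \<le> sep_number Bin 2 (bowen_metric met shift (19 * len n))"
  proof (rule sep_number_ge[OF bound])
    show "signal n ` messages n \<subseteq> Bin" using signal_Bin by blast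
    show "eps_separated (bowen_metric met shift (19 * len n)) 2 (signal n ` messages n)"
      unfolding eps_separated_def
    proof (intro ballI impI)
      fix x y assume "x \<in> signal n ` messages n" "y \<in> signal n ` messages n" "x \<noteq> y"
      then obtain v w where "v \<in> messages n" "w \<in> messages n" "x = signal n v" "y = signal n w" "v \<noteq> w"
        by blast
      then obtain t where "t < 19 * len n" "((shift ^^ t) x, (shift ^^ t) y) \<in> far"
        using signals_far by blast
      then show "2 \<le> bowen_metric met shift (19 * len n) x y"
        using met_far by (auto simp: bowen_ge[OF T])
    qed
  qed simp_all
  then show ?thesis by (simp add: card_image inj_signal card_messages)
qed

lemma len_at_top: "filterlim len at_top sequentially"
proof (rule filterlim_subseq)
  show "strict_mono len" by (rule strict_monoI) (simp add: len_def power_strict_increasing)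
qed

lemma liminf_sep:
  "liminf (\<lambda>T. ereal (sep_rate Bin met shift 2 T)) \<le> ereal (ln 2 / 9)"
proof -
  define r where "r n = 36 * len n" for n
  have r: "strict_mono r"
    unfolding r_def len_def by (rule strict_monoI) (simp add: power_strict_increasing)
  have ev: "\<forall>\<^sub>F l in sequentially. 36 * real l * (real l * (19 * real l * 5 ^ l)) \<le> 16 ^ l"
    by real_asymp
  have "\<forall>\<^sub>F n in sequentially. sep_rate Bin met shift 2 (r n) \<le> ln 2 / (36 * real (len n)) + ln 2 / 9"
    using filterlim_iff[THEN iffD1, OF len_at_top, rule_format, OF ev]
  proof eventually_elim
    case (elim n)
    define l where "l = len n"
    define N where "N = sep_number Bin 2 (bowen_metric met shift (36 * l))"
    have "0 < l" by (simp add: l_def)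
    have "Suc n \<le> l"
    proof -
      have "n < 2 ^ n" by (rule less_exp)
      also have "(2::nat) ^ n \<le> 36 ^ n" by (rule power_mono) auto
      finally show ?thesis by (simp add: l_def len_def)
    qed
    \<comment> \<open>The window \<open>36 * l\<close> has the length of \<open>4 * l\<close> codewords and of the pause at the next level.\<close>
    have "N \<le> 36 * l * (Suc n * (19 * l * 5 ^ l)) + 2 ^ (4 * l)"
      unfolding N_def l_def by (intro sep_number_le sep_upper) (auto simp: len_def)
    also have "\<dots> \<le> 36 * l * (l * (19 * l * 5 ^ l)) + 16 ^ l"
      using \<open>Suc n \<le> l\<close> by (intro add_mono mult_mono) (auto simp: power_mult)
    finally have "real N \<le> real (36 * l * (l * (19 * l * 5 ^ l)) + 16 ^ l)" by (rule of_nat_mono)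
    also have "\<dots> \<le> 2 * 16 ^ l" using elim by (simp add: l_def)
    finally have N: "real N \<le> 2 * 16 ^ l" .
    have "ln (real N) \<le> ln (2 * 16 ^ l)"
    proof (cases "N = 0")
      case False
      then show ?thesis using N by (intro ln_mono) auto
    next
      case True
      have "(1::real) \<le> 2 * 16 ^ l" using one_le_power[of "16::real" l] by linarith
      then show ?thesis using True ln_ge_zero[of "2 * 16 ^ l :: real"] by simp
    qed
    also have "ln (2 * 16 ^ l :: real) = ln 2 + real l * ln 16"
      by (simp add: ln_mult ln_realpow)
    also have "ln (16::real) = 4 * ln 2"
      using ln_realpow[of "2::real" 4] by simp
    finally have "ln (real N) / (36 * real l) \<le> (ln 2 + real l * (4 * ln 2)) / (36 * real l)"
      by (rule divide_right_mono) simp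
    also have "\<dots> = ln 2 / (36 * real l) + ln 2 / 9" using \<open>0 < l\<close> by (simp add: field_simps)
    finally show ?case by (simp add: sep_rate_def N_def l_def r_def)
  qed
  then have "limsup (\<lambda>n. ereal (sep_rate Bin met shift 2 (r n)))
      \<le> limsup (\<lambda>n. ereal (ln 2 / (36 * real (len n)) + ln 2 / 9))"
    by (intro Limsup_mono) simp
  also have "\<dots> = ereal (0 + ln 2 / 9)"
  proof (rule lim_imp_Limsup)
    have "(\<lambda>l. ln 2 / (36 * real l)) \<longlonglongrightarrow> 0" by real_asymp
    then have "(\<lambda>n. ln 2 / (36 * real (len n))) \<longlonglongrightarrow> 0"
      by (rule filterlim_compose[OF _ len_at_top])
    then show "(\<lambda>n. ereal (ln 2 / (36 * real (len n)) + ln 2 / 9)) \<longlonglongrightarrow> ereal (0 + ln 2 / 9)"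
      by (intro tendsto_intros)
  qed simp
  finally have "limsup (\<lambda>n. ereal (sep_rate Bin met shift 2 (r n))) \<le> ereal (ln 2 / 9)" by simp
  moreover have "liminf (\<lambda>n. ereal (sep_rate Bin met shift 2 (r n)))
      \<le> limsup (\<lambda>n. ereal (sep_rate Bin met shift 2 (r n)))"
    by (rule Liminf_le_Limsup) simp
  moreover have "liminf (\<lambda>T. ereal (sep_rate Bin met shift 2 T))
      \<le> liminf ((\<lambda>T. ereal (sep_rate Bin met shift 2 T)) \<circ> r)"
    by (rule liminf_subseq_mono[OF r])
  ultimately show ?thesis by (simp add: comp_def)
qed

lemma limsup_sep:
  "ereal (ln 5 / 19) \<le> limsup (\<lambda>T. ereal (sep_rate Bin met shift 2 T))"
proof -
  define r where "r n = 19 * len n" for n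
  have r: "strict_mono r"
    unfolding r_def len_def by (rule strict_monoI) (simp add: power_strict_increasing)
  have "ln 5 / 19 \<le> sep_rate Bin met shift 2 (r n)" for n
  proof -
    define N where "N = sep_number Bin 2 (bowen_metric met shift (r n))"
    have "(5::real) ^ len n \<le> real N"
      using sep_lower[of n] unfolding N_def r_def by (metis of_nat_le_iff of_nat_numeral of_nat_power)
    from ln_mono[OF this] have "real (len n) * ln 5 \<le> ln (real N)" by (simp add: ln_realpow)
    then have "real (len n) * ln 5 / (19 * real (len n)) \<le> ln (real N) / (19 * real (len n))"
      by (rule divide_right_mono) simp
    moreover have "sep_rate Bin met shift 2 (r n) = ln (real N) / (19 * real (len n))"
      by (simp add: sep_rate_def N_def r_def)
    ultimately show ?thesis by simp
  qed
  then have "ereal (ln 5 / 19) \<le> limsup (\<lambda>n. ereal (sep_rate Bin met shift 2 (r n)))"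
    by (intro le_Limsup) auto
  also have "\<dots> \<le> limsup (\<lambda>T. ereal (sep_rate Bin met shift 2 T))"
    using limsup_subseq_mono[OF r, of "\<lambda>T. ereal (sep_rate Bin met shift 2 T)"] by (simp add: comp_def)
  finally show ?thesis .
qed

lemma rate_gap: "ln 2 / 9 < ln 5 / (19::real)"
proof -
  have "19 * ln 2 = ln ((2::real) ^ 19)" by (simp only: ln_realpow of_nat_numeral)
  also have "\<dots> < ln ((5::real) ^ 9)" by simp
  also have "\<dots> = 9 * ln 5" by (simp only: ln_realpow of_nat_numeral)
  finally show ?thesis by (simp add: field_simps)
qed

lemma sep_oscillates:
  assumes "Y = Bin \<or> Y = Full"
  shows "liminf (\<lambda>T. ereal (sep_rate Y met shift 2 T)) < limsup (\<lambda>T. ereal (sep_rate Y met shift 2 T))"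
proof -
  have "sep_rate Full met shift 2 T = sep_rate Bin met shift 2 T" for T
    using sep_number_Full[of T] by (cases "T = 0") (simp_all add: sep_rate_def)
  then have "sep_rate Y met shift 2 = sep_rate Bin met shift 2" using assms by auto
  moreover have "liminf (\<lambda>T. ereal (sep_rate Bin met shift 2 T)) < limsup (\<lambda>T. ereal (sep_rate Bin met shift 2 T))"
    using liminf_sep limsup_sep rate_gap by (meson ereal_less_eq(3) le_less_trans less_ereal.simps(1) less_le_trans)
  ultimately show ?thesis by simp
qed

section \<open>Transitivity\<close>

lemma not_transitive_Full: "\<not> top_transitive Full met shift"
proof
  assume "top_transitive Full met shift"
  then obtain x where x: "x \<in> Full" "Full.mtopology closure_of (range (\<lambda>t. (shift ^^ t) x)) = Full"
    unfolding top_transitive_def by blast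
  define y :: "int \<Rightarrow> real" where "y = (if x \<in> Bin then (\<lambda>_. 2) else (\<lambda>_. 0))"
  have y: "y \<in> Full" "x \<in> Bin \<longleftrightarrow> y \<in> Thick" "x \<in> Thick \<longleftrightarrow> y \<in> Bin"
  proof -
    have "z \<notin> Thick" if "z \<in> Bin" for z
      using that rho_Bin_Thick[of z z] by fastforce
    moreover have "(\<lambda>_. 2) \<in> Thick" "(\<lambda>_. 0) \<in> Bin" by (simp_all add: Thick_def Bin_def)
    ultimately show "y \<in> Full" "x \<in> Bin \<longleftrightarrow> y \<in> Thick" "x \<in> Thick \<longleftrightarrow> y \<in> Bin"
      using x(1) unfolding y_def by auto
  qed
  then have "y \<in> Full.mtopology closure_of (range (\<lambda>t. (shift ^^ t) x))" using x(2) by blast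
  then have "\<exists>t. (shift ^^ t) x \<in> Full.mball y 1"
    unfolding Full.metric_closure_of by force
  then obtain t where "met y ((shift ^^ t) x) < 1" by auto
  then have "rho y ((shift ^^ t) x) < 1" using rho_le_met order_le_less_trans by blast
  moreover have "rho y ((shift ^^ t) x) = 1"
    using y x(1) rho_Bin_Thick[of y "(shift ^^ t) x"] rho_Bin_Thick[of "(shift ^^ t) x" y]
      shift_funpow_Bin[of t x] shift_funpow_Thick[of t x] rho_commute by auto
  ultimately show False by simp
qed

text \<open>
  The bits of \<open>n\<close> are written at the positions from \<open>2 ^ n\<close> on. Every binary word occurs among the
  lowest bits of some number, so its forward orbit is dense.
\<close>
definition universal :: "int \<Rightarrow> real" where
  "universal i = of_bool (\<exists>n j. i = int (2 ^ n + j) \<and> j < 2 ^ n \<and> bit n j)"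

lemma universal_block:
  assumes "j < 2 ^ n" shows "universal (int (2 ^ n + j)) = of_bool (bit n j)"
proof -
  have "n' = n \<and> j' = j" if "2 ^ n + j = 2 ^ n' + j'" "j' < 2 ^ n'" for n' j' :: nat
  proof -
    have "n' = n"
    proof (rule ccontr)
      assume "n' \<noteq> n"
      then consider "Suc n \<le> n'" | "Suc n' \<le> n" by linarith
      then show False
      proof cases
        case 1
        then have "(2::nat) ^ Suc n \<le> 2 ^ n'" by (rule power_increasing) simp
        then show False using that assms by simp
      next
        case 2
        then have "(2::nat) ^ Suc n' \<le> 2 ^ n" by (rule power_increasing) simp
        then show False using that assms by simp
      qed
    qed
    then show ?thesis using that by simp
  qed
  then have "(\<exists>n' j'. 2 ^ n + j = 2 ^ n' + j' \<and> j' < 2 ^ n' \<and> bit n' j') \<longleftrightarrow> bit n j"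
    using assms by blast
  then show ?thesis unfolding universal_def of_nat_eq_iff by simp
qed

lemma exists_bits:
  fixes A :: "nat set"
  shows "\<exists>n>l. \<forall>j<l. bit n j \<longleftrightarrow> j \<in> A"
proof (induction l arbitrary: A)
  case 0
  show ?case by blast
next
  case (Suc l)
  obtain n where n: "l < n" "\<forall>j<l. bit n j \<longleftrightarrow> Suc j \<in> A"
    using Suc.IH[of "{j. Suc j \<in> A}"] by auto
  have "bit (2 * n + of_bool (0 \<in> A)) j \<longleftrightarrow> j \<in> A" if "j < Suc l" for j
    using n(2) that by (cases j) (auto simp: bit_Suc bit_0)
  then show ?case using n(1) by (intro exI[of _ "2 * n + of_bool (0 \<in> A)"]) auto
qed

lemma universal_shift:
  assumes "y \<in> Bin"
  obtains t where "\<And>i. \<bar>i\<bar> \<le> int m \<Longrightarrow> (shift ^^ t) universal i = y i"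
proof -
  obtain n where n: "Suc (2 * m) < n" "\<And>j. j < Suc (2 * m) \<Longrightarrow> bit n j \<longleftrightarrow> y (int j - int m) = 1"
    using exists_bits[of "Suc (2 * m)" "{j. y (int j - int m) = 1}"] by blast
  have "(shift ^^ (2 ^ n + m)) universal i = y i" if i: "\<bar>i\<bar> \<le> int m" for i
  proof -
    define j where "j = nat (i + int m)"
    have j: "int j = i + int m" "j < Suc (2 * m)" using i by (auto simp: j_def)
    have "j < 2 ^ n" using j(2) n(1) less_exp[of n] by linarith
    have "(shift ^^ (2 ^ n + m)) universal i = universal (int (2 ^ n + j))"
      using j(1) by (simp add: shift_funpow add_ac)
    also have "\<dots> = of_bool (y i = 1)"
      using universal_block[OF \<open>j < 2 ^ n\<close>] n(2)[OF j(2)] j(1) by simp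
    also have "\<dots> = y i" using assms by (auto simp: Bin_def split: if_splits dest!: spec[of _ i])
    finally show ?thesis .
  qed
  then show ?thesis by (rule that)
qed

interpretation Bin: Metric_space Bin met
  by (rule Full.subspace[OF Un_upper1])

lemma transitive_Bin: "top_transitive Bin met shift"
  unfolding top_transitive_def
proof
  show U: "universal \<in> Bin" by (auto simp: Bin_def universal_def)
  have "\<exists>t. (shift ^^ t) universal \<in> Bin.mball y e" if y: "y \<in> Bin" and "0 < e" for y e
  proof -
    obtain m where m: "(1/2) ^ m < min e 1" using real_arch_pow_inv[of "min e 1" "1/2"] \<open>0 < e\<close> by auto
    obtain t where t: "\<And>i. \<bar>i\<bar> \<le> int (9 + m) \<Longrightarrow> (shift ^^ t) universal i = y i"
      using universal_shift[OF y] by blast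
    have "rho y ((shift ^^ t) universal) \<le> (1/2) ^ m"
      by (rule rho_le_window[where m = m]) (simp_all add: t)
    moreover have "(shift ^^ t) universal \<in> Bin" using U by (simp only: shift_funpow_Bin)
    ultimately show ?thesis using y m met_eq_rho[of y "(shift ^^ t) universal"] by auto
  qed
  then show "Bin.mtopology closure_of (range (\<lambda>t. (shift ^^ t) universal)) = Bin"
    unfolding Bin.metric_closure_of by blast
qed

section \<open>The example\<close>

lemma liminf_eq_limsup:
  fixes f :: "nat \<Rightarrow> real"
  assumes "f \<longlonglongrightarrow> c" shows "liminf (\<lambda>T. ereal (f T)) = limsup (\<lambda>T. ereal (f T))"
proof -
  have "(\<lambda>T. ereal (f T)) \<longlonglongrightarrow> ereal c" using assms by simp
  then show ?thesis
    using lim_imp_Liminf[OF sequentially_bot] lim_imp_Limsup[OF sequentially_bot] by metis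
qed

theorem theorem3:
  "\<exists>(X :: (int \<Rightarrow> real) set) (D :: (int \<Rightarrow> real) \<Rightarrow> (int \<Rightarrow> real) \<Rightarrow> real)
     (F :: (int \<Rightarrow> real) \<Rightarrow> (int \<Rightarrow> real)) (W :: (int \<Rightarrow> real) set).
     Metric_space X D \<and> F ` X \<subseteq> X \<and> W \<subseteq> X \<and> F ` W \<subseteq> W \<and>
     compactin (Metric_space.mtopology X D) X \<and>
     compactin (Metric_space.mtopology X D) W \<and>
     homeomorphic_map (Metric_space.mtopology X D) (Metric_space.mtopology X D) F \<and>
     homeomorphic_map (subtopology (Metric_space.mtopology X D) W)
                      (subtopology (Metric_space.mtopology X D) W) F \<and>
     (\<exists>\<epsilon>>0.
        liminf (\<lambda>T. ereal (sep_rate X D F \<epsilon> T)) < limsup (\<lambda>T. ereal (sep_rate X D F \<epsilon> T)) \<and>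
        liminf (\<lambda>T. ereal (sep_rate W D F \<epsilon> T)) < limsup (\<lambda>T. ereal (sep_rate W D F \<epsilon> T)) \<and>
        (\<forall>\<delta>>0. liminf (\<lambda>T. ereal (span_rate W D F \<delta> T)) =
                limsup (\<lambda>T. ereal (span_rate W D F \<delta> T))) \<and>
        (\<exists>\<delta>s. 0 < \<delta>s \<and> \<delta>s < \<epsilon> \<and>
           (\<forall>\<delta>>\<delta>s. span_rate X D F \<delta> \<longlonglongrightarrow> 0 \<and> span_rate W D F \<delta> \<longlonglongrightarrow> 0) \<and>
           (\<forall>\<delta>. 0 < \<delta> \<and> \<delta> \<le> \<delta>s \<longrightarrow> span_rate W D F \<delta> \<longlonglongrightarrow> ln 2))) \<and>
     top_entropy X D F = \<infinity> \<and> top_entropy W D F = ereal (ln 2) \<and>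
     \<not> top_transitive X D F \<and> top_transitive W D F"
proof (rule exI[of _ Full], rule exI[of _ met], rule exI[of _ shift], rule exI[of _ Bin],
    intro conjI)
  show "Metric_space Full met" by (rule Metric_space_Full)
  show "shift ` Full \<subseteq> Full" using shift_Bin shift_Thick by blast
  show "Bin \<subseteq> Full" by (rule Un_upper1)
  show "shift ` Bin \<subseteq> Bin" by (simp add: shift_image_Bin)
  show "\<exists>\<epsilon>>0.
        liminf (\<lambda>T. ereal (sep_rate Full met shift \<epsilon> T)) < limsup (\<lambda>T. ereal (sep_rate Full met shift \<epsilon> T)) \<and>
        liminf (\<lambda>T. ereal (sep_rate Bin met shift \<epsilon> T)) < limsup (\<lambda>T. ereal (sep_rate Bin met shift \<epsilon> T)) \<and>
        (\<forall>\<delta>>0. liminf (\<lambda>T. ereal (span_rate Bin met shift \<delta> T)) =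
                limsup (\<lambda>T. ereal (span_rate Bin met shift \<delta> T))) \<and>
        (\<exists>\<delta>s. 0 < \<delta>s \<and> \<delta>s < \<epsilon> \<and>
           (\<forall>\<delta>>\<delta>s. span_rate Full met shift \<delta> \<longlonglongrightarrow> 0 \<and> span_rate Bin met shift \<delta> \<longlonglongrightarrow> 0) \<and>
           (\<forall>\<delta>. 0 < \<delta> \<and> \<delta> \<le> \<delta>s \<longrightarrow> span_rate Bin met shift \<delta> \<longlonglongrightarrow> ln 2))"
  proof (rule exI[of _ 2], intro conjI allI impI)
    fix \<delta> :: real assume "0 < \<delta>"
    show "liminf (\<lambda>T. ereal (span_rate Bin met shift \<delta> T)) = limsup (\<lambda>T. ereal (span_rate Bin met shift \<delta> T))"
    proof (cases "\<delta> \<le> 1")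
      case True
      then show ?thesis by (intro liminf_eq_limsup[OF span_rate_Bin_small] \<open>0 < \<delta>\<close>)
    next
      case False
      then show ?thesis by (intro liminf_eq_limsup[OF span_rate_large]) auto
    qed
  next
    show "\<exists>\<delta>s. 0 < \<delta>s \<and> \<delta>s < 2 \<and>
           (\<forall>\<delta>>\<delta>s. span_rate Full met shift \<delta> \<longlonglongrightarrow> 0 \<and> span_rate Bin met shift \<delta> \<longlonglongrightarrow> 0) \<and>
           (\<forall>\<delta>. 0 < \<delta> \<and> \<delta> \<le> \<delta>s \<longrightarrow> span_rate Bin met shift \<delta> \<longlonglongrightarrow> ln 2)"
      by (intro exI[of _ 1] conjI allI impI span_rate_large span_rate_Bin_small) auto
  qed (simp_all add: sep_oscillates)
qed (fact compactin_Full compactin_Bin homeomorphic_shift homeomorphic_shift_Bin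
       top_entropy_Full top_entropy_Bin not_transitive_Full transitive_Bin)+

end
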